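(* Let $k$ be a field, let $A$ and $B$ be $k$-algebras with unit, and let $R: B\otimes A\to A\otimes B$ be a normal and multiplicative $k$-linear map. Let $X$ be a $k$-algebra and let $u: A\to X$, $v: B\to X$ be algebra morphisms such that $$m_X\circ(v\otimes u)=m_X\circ(u\otimes v)\circ R .$$ Then there is a unique algebra map $w: A\#_R B\to X$ such that $w\circ i_A=u$ and $w\circ i_B=v$.
   Context: All tensor products are over $k$; algebras are associative and unital, and algebra maps preserve units; $m_A$ denotes the multiplication and $I_A$ the identity map of an algebra $A$. $R$ is normal if $R(b\otimes 1_A)=1_A\otimes b$ for all $b\in B$ and $R(1_B\otimes a)=a\otimes 1_B$ for all $a\in A$. $R$ is multiplicative if $$R\circ(m_B\otimes I_A)=(I_A\otimes m_B)\circ(R\otimes I_B)\circ(I_B\otimes R)\quad\text{on } B\otimes B\otimes A,$$ $$R\circ(I_B\otimes m_A)=(m_A\otimes I_B)\circ(I_A\otimes R)\circ(R\otimes I_A)\quad\text{on } B\otimes A\otimes A.$$ $A\#_R B$ is the vector space $A\otimes B$ with multiplication $(m_A\otimes m_B)\circ(I_A\otimes R\otimes I_B)$; when $R$ is normal and multiplicative this is an associative algebra with unit $1_A\otimes 1_B$. Write $a\#_R b$ for $a\otimes b$ viewed in $A\#_R B$. The maps $i_A: A\to A\#_R B$, $i_A(a)=a\#_R 1_B$, and $i_B: B\to A\#_R B$, $i_B(b)=1_A\#_R b$, are algebra maps. *)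

theory Defs
  imports "HOL-Algebra.Module" "HOL-Algebra.AbelCoset"
begin

section \<open>Algebras and their maps\<close>

text \<open>
  The library locale \<open>algebra\<close> requires a commutative multiplication, so it is not used here.
  As \<open>ring\<close> does not require \<open>\<one> \<noteq> \<zero>\<close>, the zero algebra is included.
\<close>

locale unital_algebra = K?: field K + module K A + A?: ring A
  for K (structure) and A (structure) +
  assumes smult_mult_left:
      "\<lbrakk>c \<in> carrier K; x \<in> carrier A; y \<in> carrier A\<rbrakk> \<Longrightarrow>
        (c \<odot>\<^bsub>A\<^esub> x) \<otimes>\<^bsub>A\<^esub> y = c \<odot>\<^bsub>A\<^esub> (x \<otimes>\<^bsub>A\<^esub> y)"
    and smult_mult_right:
      "\<lbrakk>c \<in> carrier K; x \<in> carrier A; y \<in> carrier A\<rbrakk> \<Longrightarrow>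
        x \<otimes>\<^bsub>A\<^esub> (c \<odot>\<^bsub>A\<^esub> y) = c \<odot>\<^bsub>A\<^esub> (x \<otimes>\<^bsub>A\<^esub> y)"

definition linear_maps ::
  "('k, 'r) ring_scheme \<Rightarrow> ('k, 'm, 'x) module_scheme \<Rightarrow> ('k, 'n, 'y) module_scheme \<Rightarrow> ('m \<Rightarrow> 'n) set" where
  "linear_maps K M N =
    {f \<in> carrier M \<rightarrow> carrier N.
      (\<forall>x\<in>carrier M. \<forall>y\<in>carrier M. f (x \<oplus>\<^bsub>M\<^esub> y) = f x \<oplus>\<^bsub>N\<^esub> f y) \<and>
      (\<forall>c\<in>carrier K. \<forall>x\<in>carrier M. f (c \<odot>\<^bsub>M\<^esub> x) = c \<odot>\<^bsub>N\<^esub> f x)}"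

definition algebra_maps ::
  "('k, 'r) ring_scheme \<Rightarrow> ('k, 'm, 'x) module_scheme \<Rightarrow> ('k, 'n, 'y) module_scheme \<Rightarrow> ('m \<Rightarrow> 'n) set" where
  "algebra_maps K M N = linear_maps K M N \<inter> ring_hom M N"


section \<open>Tensor products\<close>

text \<open>
  \<open>M \<otimes> N\<close> is the free module on \<open>carrier M \<times> carrier N\<close> modulo the submodule generated by the
  bilinearity relations. These constructions only produce modules; the \<open>mult\<close> and \<open>one\<close> fields
  of the resulting records are unspecified.
\<close>

definition free_module :: "('k, 'r) ring_scheme \<Rightarrow> 's set \<Rightarrow> ('k, 's \<Rightarrow> 'k) module" where
  "free_module K S =
    \<lparr>carrier = {f. (\<forall>s. f s \<in> carrier K) \<and> finite {s. f s \<noteq> \<zero>\<^bsub>K\<^esub>} \<and> {s. f s \<noteq> \<zero>\<^bsub>K\<^esub>} \<subseteq> S},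
     mult = undefined, one = undefined,
     zero = (\<lambda>s. \<zero>\<^bsub>K\<^esub>), add = (\<lambda>f g s. f s \<oplus>\<^bsub>K\<^esub> g s),
     smult = (\<lambda>c f s. c \<otimes>\<^bsub>K\<^esub> f s)\<rparr>"

definition free_gen :: "('k, 'r) ring_scheme \<Rightarrow> 's \<Rightarrow> 's \<Rightarrow> 'k" where
  "free_gen K s = (\<lambda>t. if t = s then \<one>\<^bsub>K\<^esub> else \<zero>\<^bsub>K\<^esub>)"

definition generated_submodule ::
  "('k, 'r) ring_scheme \<Rightarrow> ('k, 'm, 'x) module_scheme \<Rightarrow> 'm set \<Rightarrow> 'm set" where
  "generated_submodule K M S = \<Inter>{H. submodule H K M \<and> S \<subseteq> H}"

definition quotient_module :: "('k, 'm, 'x) module_scheme \<Rightarrow> 'm set \<Rightarrow> ('k, 'm set) module" where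
  "quotient_module M H =
    \<lparr>carrier = a_rcosets\<^bsub>M\<^esub> H, mult = undefined, one = undefined,
     zero = H, add = set_add M,
     smult = (\<lambda>c C. \<Union>x\<in>C. H +>\<^bsub>M\<^esub> (c \<odot>\<^bsub>M\<^esub> x))\<rparr>"

definition bilinear_relators ::
  "('k, 'r) ring_scheme \<Rightarrow> ('k, 'm, 'x) module_scheme \<Rightarrow> ('k, 'n, 'y) module_scheme \<Rightarrow>
    ('m \<times> 'n \<Rightarrow> 'k) set" where
  "bilinear_relators K M N =
    (let F = free_module K (carrier M \<times> carrier N); e = (\<lambda>m n. free_gen K (m, n)) in
      {e (m \<oplus>\<^bsub>M\<^esub> m') n \<ominus>\<^bsub>F\<^esub> (e m n \<oplus>\<^bsub>F\<^esub> e m' n) | m m' n.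
         m \<in> carrier M \<and> m' \<in> carrier M \<and> n \<in> carrier N} \<union>
      {e m (n \<oplus>\<^bsub>N\<^esub> n') \<ominus>\<^bsub>F\<^esub> (e m n \<oplus>\<^bsub>F\<^esub> e m n') | m n n'.
         m \<in> carrier M \<and> n \<in> carrier N \<and> n' \<in> carrier N} \<union>
      {e (c \<odot>\<^bsub>M\<^esub> m) n \<ominus>\<^bsub>F\<^esub> (c \<odot>\<^bsub>F\<^esub> e m n) | c m n.
         c \<in> carrier K \<and> m \<in> carrier M \<and> n \<in> carrier N} \<union>
      {e m (c \<odot>\<^bsub>N\<^esub> n) \<ominus>\<^bsub>F\<^esub> (c \<odot>\<^bsub>F\<^esub> e m n) | c m n.
         c \<in> carrier K \<and> m \<in> carrier M \<and> n \<in> carrier N})"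

definition tensor_relations ::
  "('k, 'r) ring_scheme \<Rightarrow> ('k, 'm, 'x) module_scheme \<Rightarrow> ('k, 'n, 'y) module_scheme \<Rightarrow>
    ('m \<times> 'n \<Rightarrow> 'k) set" where
  "tensor_relations K M N =
    generated_submodule K (free_module K (carrier M \<times> carrier N)) (bilinear_relators K M N)"

definition tensor ::
  "('k, 'r) ring_scheme \<Rightarrow> ('k, 'm, 'x) module_scheme \<Rightarrow> ('k, 'n, 'y) module_scheme \<Rightarrow>
    ('k, ('m \<times> 'n \<Rightarrow> 'k) set) module" where
  "tensor K M N =
    quotient_module (free_module K (carrier M \<times> carrier N)) (tensor_relations K M N)"

definition pure_tensor ::
  "('k, 'r) ring_scheme \<Rightarrow> ('k, 'm, 'x) module_scheme \<Rightarrow> ('k, 'n, 'y) module_scheme \<Rightarrow>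
    'm \<Rightarrow> 'n \<Rightarrow> ('m \<times> 'n \<Rightarrow> 'k) set" where
  "pure_tensor K M N m n =
    tensor_relations K M N +>\<^bsub>free_module K (carrier M \<times> carrier N)\<^esub> free_gen K (m, n)"

text \<open>
  For \<open>\<beta>\<close> bilinear on \<open>M \<times> N\<close> with values in \<open>P\<close>, \<open>tensor_lift K P \<beta>\<close> is the linear map
  from \<open>M \<otimes> N\<close> to \<open>P\<close> with \<open>m \<otimes> n \<mapsto> \<beta> m n\<close>. The value does not depend on the chosen
  representative \<open>f\<close> of the coset \<open>t\<close>.
\<close>

definition tensor_lift ::
  "('k, 'r) ring_scheme \<Rightarrow> ('k, 'p, 'z) module_scheme \<Rightarrow> ('m \<Rightarrow> 'n \<Rightarrow> 'p) \<Rightarrow>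
    ('m \<times> 'n \<Rightarrow> 'k) set \<Rightarrow> 'p" where
  "tensor_lift K P \<beta> t =
    (let f = (SOME f. f \<in> t) in
      \<Oplus>\<^bsub>P\<^esub>s\<in>{s. f s \<noteq> \<zero>\<^bsub>K\<^esub>}. f s \<odot>\<^bsub>P\<^esub> \<beta> (fst s) (snd s))"

text \<open>
  In \<open>tensor_map K P Q f g\<close> the modules \<open>P\<close> and \<open>Q\<close> are the codomains of \<open>f\<close> and \<open>g\<close>.
\<close>

definition tensor_map ::
  "('k, 'r) ring_scheme \<Rightarrow> ('k, 'p, 'x) module_scheme \<Rightarrow> ('k, 'q, 'y) module_scheme \<Rightarrow>
    ('m \<Rightarrow> 'p) \<Rightarrow> ('n \<Rightarrow> 'q) \<Rightarrow> ('m \<times> 'n \<Rightarrow> 'k) set \<Rightarrow> ('p \<times> 'q \<Rightarrow> 'k) set" where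
  "tensor_map K P Q f g = tensor_lift K (tensor K P Q) (\<lambda>m n. pure_tensor K P Q (f m) (g n))"

text \<open>\<open>(M \<otimes> N) \<otimes> P \<longrightarrow> M \<otimes> (N \<otimes> P)\<close>\<close>

definition tensor_assoc ::
  "('k, 'r) ring_scheme \<Rightarrow> ('k, 'm, 'x) module_scheme \<Rightarrow> ('k, 'n, 'y) module_scheme \<Rightarrow>
    ('k, 'p, 'z) module_scheme \<Rightarrow>
    (('m \<times> 'n \<Rightarrow> 'k) set \<times> 'p \<Rightarrow> 'k) set \<Rightarrow> ('m \<times> ('n \<times> 'p \<Rightarrow> 'k) set \<Rightarrow> 'k) set" where
  "tensor_assoc K M N P =
    (let NP = tensor K N P; T = tensor K M NP in
      tensor_lift K T (\<lambda>t p. tensor_lift K T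
        (\<lambda>m n. pure_tensor K M NP m (pure_tensor K N P n p)) t))"

text \<open>\<open>M \<otimes> (N \<otimes> P) \<longrightarrow> (M \<otimes> N) \<otimes> P\<close>\<close>

definition tensor_unassoc ::
  "('k, 'r) ring_scheme \<Rightarrow> ('k, 'm, 'x) module_scheme \<Rightarrow> ('k, 'n, 'y) module_scheme \<Rightarrow>
    ('k, 'p, 'z) module_scheme \<Rightarrow>
    ('m \<times> ('n \<times> 'p \<Rightarrow> 'k) set \<Rightarrow> 'k) set \<Rightarrow> (('m \<times> 'n \<Rightarrow> 'k) set \<times> 'p \<Rightarrow> 'k) set" where
  "tensor_unassoc K M N P =
    (let MN = tensor K M N; T = tensor K MN P in
      tensor_lift K T (\<lambda>m t. tensor_lift K T
        (\<lambda>n p. pure_tensor K MN P (pure_tensor K M N m n) p) t))"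

definition mult_map ::
  "('k, 'r) ring_scheme \<Rightarrow> ('k, 'a, 'x) module_scheme \<Rightarrow> ('a \<times> 'a \<Rightarrow> 'k) set \<Rightarrow> 'a" where
  "mult_map K A = tensor_lift K A (\<lambda>x y. x \<otimes>\<^bsub>A\<^esub> y)"


section \<open>Smash products\<close>

definition normal_twist ::
  "('k, 'r) ring_scheme \<Rightarrow> ('k, 'a, 'x) module_scheme \<Rightarrow> ('k, 'b, 'y) module_scheme \<Rightarrow>
    (('b \<times> 'a \<Rightarrow> 'k) set \<Rightarrow> ('a \<times> 'b \<Rightarrow> 'k) set) \<Rightarrow> bool" where
  "normal_twist K A B R \<longleftrightarrow>
    (\<forall>b\<in>carrier B. R (pure_tensor K B A b \<one>\<^bsub>A\<^esub>) = pure_tensor K A B \<one>\<^bsub>A\<^esub> b) \<and>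
    (\<forall>a\<in>carrier A. R (pure_tensor K B A \<one>\<^bsub>B\<^esub> a) = pure_tensor K A B a \<one>\<^bsub>B\<^esub>)"

text \<open>
  The two identities on \<open>B \<otimes> B \<otimes> A\<close> and \<open>B \<otimes> A \<otimes> A\<close>, with the rebracketing
  isomorphisms inserted; the triple products are bracketed as \<open>(B \<otimes> B) \<otimes> A\<close> and
  \<open>B \<otimes> (A \<otimes> A)\<close>.
\<close>

definition multiplicative_twist ::
  "('k, 'r) ring_scheme \<Rightarrow> ('k, 'a, 'x) module_scheme \<Rightarrow> ('k, 'b, 'y) module_scheme \<Rightarrow>
    (('b \<times> 'a \<Rightarrow> 'k) set \<Rightarrow> ('a \<times> 'b \<Rightarrow> 'k) set) \<Rightarrow> bool" where
  "multiplicative_twist K A B R \<longleftrightarrow>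
    (\<forall>t\<in>carrier (tensor K (tensor K B B) A).
      (R \<circ> tensor_map K B A (mult_map K B) id) t =
      (tensor_map K A B id (mult_map K B) \<circ>
       tensor_assoc K A B B \<circ>
       tensor_map K (tensor K A B) B R id \<circ>
       tensor_unassoc K B A B \<circ>
       tensor_map K B (tensor K A B) id R \<circ>
       tensor_assoc K B B A) t) \<and>
    (\<forall>t\<in>carrier (tensor K B (tensor K A A)).
      (R \<circ> tensor_map K B A id (mult_map K A)) t =
      (tensor_map K A B (mult_map K A) id \<circ>
       tensor_unassoc K A A B \<circ>
       tensor_map K A (tensor K A B) id R \<circ>
       tensor_assoc K A B A \<circ>
       tensor_map K (tensor K A B) A R id \<circ>
       tensor_unassoc K B A A) t)"

text \<open>
  \<open>(m\<^sub>A \<otimes> m\<^sub>B) \<circ> (I\<^sub>A \<otimes> R \<otimes> I\<^sub>B)\<close> as a map \<open>(A \<otimes> B) \<otimes> (A \<otimes> B) \<longrightarrow> A \<otimes> B\<close>: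
  the innermost two maps rebracket to \<open>A \<otimes> ((B \<otimes> A) \<otimes> B)\<close>, and after applying \<open>R\<close> the
  result is rebracketed to \<open>(A \<otimes> A) \<otimes> (B \<otimes> B)\<close>.
\<close>

definition smash_mult_map ::
  "('k, 'r) ring_scheme \<Rightarrow> ('k, 'a, 'x) module_scheme \<Rightarrow> ('k, 'b, 'y) module_scheme \<Rightarrow>
    (('b \<times> 'a \<Rightarrow> 'k) set \<Rightarrow> ('a \<times> 'b \<Rightarrow> 'k) set) \<Rightarrow>
    (('a \<times> 'b \<Rightarrow> 'k) set \<times> ('a \<times> 'b \<Rightarrow> 'k) set \<Rightarrow> 'k) set \<Rightarrow> ('a \<times> 'b \<Rightarrow> 'k) set" where
  "smash_mult_map K A B R =
    tensor_map K A B (mult_map K A) (mult_map K B) \<circ>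
    tensor_unassoc K A A (tensor K B B) \<circ>
    tensor_map K A (tensor K A (tensor K B B)) id (tensor_assoc K A B B) \<circ>
    tensor_map K A (tensor K (tensor K A B) B) id (tensor_map K (tensor K A B) B R id) \<circ>
    tensor_map K A (tensor K (tensor K B A) B) id (tensor_unassoc K B A B) \<circ>
    tensor_assoc K A B (tensor K A B)"

definition smash_product ::
  "('k, 'r) ring_scheme \<Rightarrow> ('k, 'a, 'x) module_scheme \<Rightarrow> ('k, 'b, 'y) module_scheme \<Rightarrow>
    (('b \<times> 'a \<Rightarrow> 'k) set \<Rightarrow> ('a \<times> 'b \<Rightarrow> 'k) set) \<Rightarrow> ('k, ('a \<times> 'b \<Rightarrow> 'k) set) module" where
  "smash_product K A B R =
    (tensor K A B)
      \<lparr>mult := (\<lambda>s t. smash_mult_map K A B R (pure_tensor K (tensor K A B) (tensor K A B) s t)),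
       one := pure_tensor K A B \<one>\<^bsub>A\<^esub> \<one>\<^bsub>B\<^esub>\<rparr>"

definition smash_left ::
  "('k, 'r) ring_scheme \<Rightarrow> ('k, 'a, 'x) module_scheme \<Rightarrow> ('k, 'b, 'y) module_scheme \<Rightarrow>
    'a \<Rightarrow> ('a \<times> 'b \<Rightarrow> 'k) set" where
  "smash_left K A B a = pure_tensor K A B a \<one>\<^bsub>B\<^esub>"

definition smash_right ::
  "('k, 'r) ring_scheme \<Rightarrow> ('k, 'a, 'x) module_scheme \<Rightarrow> ('k, 'b, 'y) module_scheme \<Rightarrow>
    'b \<Rightarrow> ('a \<times> 'b \<Rightarrow> 'k) set" where
  "smash_right K A B b = pure_tensor K A B \<one>\<^bsub>A\<^esub> b"

end

(*
  The map must send a # b = (a # 1)(1 # b), an identity due to normality, to u(a) v(b); this gives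
  uniqueness, and defines w as the linear map induced by the bilinear map (a, b) |-> u(a) v(b).
  For existence, left multiplication by a on A tensored with right multiplication by b' on B, applied
  to R(b (x) a'), is the product (a # b)(a' # b'). Since u and v are multiplicative, w sends it to
  u(a) w(R(b (x) a')) v(b'), and the commutation hypothesis says that w(R(b (x) a')) = v(b) u(a').
*)
theory Submission
  imports Defs
begin

section \<open>Linear and bilinear maps\<close>

text \<open>A tensor product is here a concrete set of cosets in a free module, and
  \<open>tensor_lift\<close> evaluates on a representative chosen by \<open>SOME\<close>. Hence the
  weight on the universal property: a lift vanishes on all relations, so the choice is harmless, and
  from then on a linear map out of a tensor product is known from its values on pure tensors. The
  obstacle is that R(b (x) a') has no formula. It is in general a sum of pure tensors, so the six
  maps composing the product can be evaluated on a pure tensor up to R and no further. The remedy is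
  to regard the remaining maps as one linear function of a variable r in A (x) B, compare it with
  the wanted function at r = x (x) y, and only then put r = R(b (x) a'). The same device computes w
  after left and right multiplication. HOL functions are total, so uniqueness can only hold once the
  values off the carrier are fixed; this is why the final map is a restriction.\<close>

lemma linear_mapsI:
  assumes "\<And>x. x \<in> carrier M \<Longrightarrow> f x \<in> carrier N"
    and "\<And>x y. x \<in> carrier M \<Longrightarrow> y \<in> carrier M \<Longrightarrow> f (x \<oplus>\<^bsub>M\<^esub> y) = f x \<oplus>\<^bsub>N\<^esub> f y"
    and "\<And>c x. c \<in> carrier K \<Longrightarrow> x \<in> carrier M \<Longrightarrow> f (c \<odot>\<^bsub>M\<^esub> x) = c \<odot>\<^bsub>N\<^esub> f x"
  shows "f \<in> linear_maps K M N"
  using assms by (auto simp: linear_maps_def)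

lemma linear_mapsD:
  assumes "f \<in> linear_maps K M N"
  shows linear_maps_closed: "x \<in> carrier M \<Longrightarrow> f x \<in> carrier N"
    and linear_maps_add: "x \<in> carrier M \<Longrightarrow> y \<in> carrier M \<Longrightarrow> f (x \<oplus>\<^bsub>M\<^esub> y) = f x \<oplus>\<^bsub>N\<^esub> f y"
    and linear_maps_smult: "c \<in> carrier K \<Longrightarrow> x \<in> carrier M \<Longrightarrow> f (c \<odot>\<^bsub>M\<^esub> x) = c \<odot>\<^bsub>N\<^esub> f x"
  using assms by (auto simp: linear_maps_def)

text \<open>Linearity concerns only values on the carrier, which is closed under the operations.
  This allows replacing a map by its restriction, and rewriting a map with equations that hold on
  the carrier alone.\<close>

lemma linear_maps_cong:
  assumes "f \<in> linear_maps K M N" "module K M" "\<And>x. x \<in> carrier M \<Longrightarrow> g x = f x"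
  shows "g \<in> linear_maps K M N"
proof -
  interpret M: module K M by fact
  show ?thesis using assms(1,3) by (auto simp: linear_maps_def)
qed

lemma linear_maps_comp:
  "f \<in> linear_maps K M N \<Longrightarrow> g \<in> linear_maps K N P \<Longrightarrow> g \<circ> f \<in> linear_maps K M P"
  by (auto simp: linear_maps_def Pi_def)

lemma linear_maps_id: "id \<in> linear_maps K M M"
  by (simp add: linear_maps_def)

lemma linear_maps_zero:
  assumes "f \<in> linear_maps K M N" "module K M" "module K N"
  shows "f \<zero>\<^bsub>M\<^esub> = \<zero>\<^bsub>N\<^esub>"
proof -
  interpret M: module K M by fact
  interpret N: module K N by fact
  have "f (\<zero>\<^bsub>K\<^esub> \<odot>\<^bsub>M\<^esub> \<zero>\<^bsub>M\<^esub>) = \<zero>\<^bsub>K\<^esub> \<odot>\<^bsub>N\<^esub> f \<zero>\<^bsub>M\<^esub>"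
    using assms(1) by (intro linear_maps_smult) auto
  then show ?thesis
    using linear_maps_closed[OF assms(1), of "\<zero>\<^bsub>M\<^esub>"] by simp
qed

lemma linear_maps_minus:
  assumes "f \<in> linear_maps K M N" "module K M" "module K N" "x \<in> carrier M" "y \<in> carrier M"
  shows "f (x \<ominus>\<^bsub>M\<^esub> y) = f x \<ominus>\<^bsub>N\<^esub> f y"
proof -
  interpret M: module K M by fact
  interpret N: module K N by fact
  have "f (x \<ominus>\<^bsub>M\<^esub> y) = f (x \<oplus>\<^bsub>M\<^esub> (\<ominus>\<^bsub>K\<^esub> \<one>\<^bsub>K\<^esub>) \<odot>\<^bsub>M\<^esub> y)"
    using assms(4,5) by (simp add: a_minus_def M.smult_l_minus)
  also have "\<dots> = f x \<oplus>\<^bsub>N\<^esub> (\<ominus>\<^bsub>K\<^esub> \<one>\<^bsub>K\<^esub>) \<odot>\<^bsub>N\<^esub> f y"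
    using assms(4,5) by (simp add: linear_mapsD[OF assms(1)])
  finally show ?thesis
    using assms(4,5) by (simp add: a_minus_def N.smult_l_minus linear_mapsD[OF assms(1)])
qed

lemma linear_maps_pointwise_add:
  assumes "f \<in> linear_maps K M N" "g \<in> linear_maps K M N" "module K N"
  shows "(\<lambda>x. f x \<oplus>\<^bsub>N\<^esub> g x) \<in> linear_maps K M N"
proof -
  interpret N: module K N by fact
  show ?thesis
    using assms(1,2)
    by (intro linear_mapsI) (auto simp: linear_mapsD N.smult_r_distr N.a_ac)
qed

text \<open>Used for the lift on the free module: once its kernel is a submodule, it contains the
  span of the bilinearity relations as soon as it contains the relations themselves.\<close>

lemma submodule_kernel:
  assumes "f \<in> linear_maps K M N" "module K M" "module K N"
  shows "submodule {x \<in> carrier M. f x = \<zero>\<^bsub>N\<^esub>} K M"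
proof -
  interpret M: module K M by fact
  interpret N: module K N by fact
  have "f (\<ominus>\<^bsub>M\<^esub> x) = \<ominus>\<^bsub>N\<^esub> f x" if "x \<in> carrier M" for x
    using linear_maps_minus[OF assms, of "\<zero>\<^bsub>M\<^esub>" x] linear_maps_zero[OF assms] that
    by (simp add: a_minus_def linear_mapsD[OF assms(1)])
  then show ?thesis
    using linear_maps_zero[OF assms]
    by (intro M.submoduleI) (auto simp: linear_mapsD[OF assms(1)])
qed

section \<open>Bilinear maps, as maps linear in each argument separately\<close>

definition bilinear ::
  "('k, 'r) ring_scheme \<Rightarrow> ('k, 'm, 'x) module_scheme \<Rightarrow> ('k, 'n, 'y) module_scheme \<Rightarrow>
    ('k, 'p, 'z) module_scheme \<Rightarrow> ('m \<Rightarrow> 'n \<Rightarrow> 'p) \<Rightarrow> bool" where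
  "bilinear K M N P \<beta> \<longleftrightarrow>
    (\<forall>m\<in>carrier M. \<beta> m \<in> linear_maps K N P) \<and>
    (\<forall>n\<in>carrier N. (\<lambda>m. \<beta> m n) \<in> linear_maps K M P)"

lemma bilinearI:
  assumes "\<And>m. m \<in> carrier M \<Longrightarrow> \<beta> m \<in> linear_maps K N P"
    and "\<And>n. n \<in> carrier N \<Longrightarrow> (\<lambda>m. \<beta> m n) \<in> linear_maps K M P"
  shows "bilinear K M N P \<beta>"
  using assms by (simp add: bilinear_def)

lemma bilinearD:
  assumes "bilinear K M N P \<beta>"
  shows bilinear_right: "m \<in> carrier M \<Longrightarrow> \<beta> m \<in> linear_maps K N P"
    and bilinear_left: "n \<in> carrier N \<Longrightarrow> (\<lambda>m. \<beta> m n) \<in> linear_maps K M P"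
  using assms by (auto simp: bilinear_def)

lemma bilinear_closed:
  "bilinear K M N P \<beta> \<Longrightarrow> m \<in> carrier M \<Longrightarrow> n \<in> carrier N \<Longrightarrow> \<beta> m n \<in> carrier P"
  using bilinear_right linear_maps_closed by metis

lemma bilinear_comp_linear:
  assumes "bilinear K M N P \<beta>" "f \<in> linear_maps K M' M" "g \<in> linear_maps K N' N"
  shows "bilinear K M' N' P (\<lambda>m n. \<beta> (f m) (g n))"
proof (rule bilinearI)
  show "(\<lambda>n. \<beta> (f m) (g n)) \<in> linear_maps K N' P" if "m \<in> carrier M'" for m
    using linear_maps_comp[OF assms(3) bilinear_right[OF assms(1)]]
      linear_maps_closed[OF assms(2) that] by (simp add: comp_def)
  show "(\<lambda>m. \<beta> (f m) (g n)) \<in> linear_maps K M' P" if "n \<in> carrier N'" for n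
    using linear_maps_comp[OF assms(2) bilinear_left[OF assms(1)]]
      linear_maps_closed[OF assms(3) that] by (simp add: comp_def)
qed

lemma linear_comp_bilinear:
  assumes "bilinear K M N P \<beta>" "f \<in> linear_maps K P Q"
  shows "bilinear K M N Q (\<lambda>m n. f (\<beta> m n))"
proof (rule bilinearI)
  show "(\<lambda>n. f (\<beta> m n)) \<in> linear_maps K N Q" if "m \<in> carrier M" for m
    using linear_maps_comp[OF bilinear_right[OF assms(1) that] assms(2)] by (simp add: comp_def)
  show "(\<lambda>m. f (\<beta> m n)) \<in> linear_maps K M Q" if "n \<in> carrier N" for n
    using linear_maps_comp[OF bilinear_left[OF assms(1) that] assms(2)] by (simp add: comp_def)
qed


section \<open>Free and quotient modules\<close>

lemma free_module_simps:
  "f \<in> carrier (free_module K S) \<longleftrightarrow>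
     (\<forall>s. f s \<in> carrier K) \<and> finite {s. f s \<noteq> \<zero>\<^bsub>K\<^esub>} \<and> {s. f s \<noteq> \<zero>\<^bsub>K\<^esub>} \<subseteq> S"
  "\<zero>\<^bsub>free_module K S\<^esub> = (\<lambda>s. \<zero>\<^bsub>K\<^esub>)"
  "f \<oplus>\<^bsub>free_module K S\<^esub> g = (\<lambda>s. f s \<oplus>\<^bsub>K\<^esub> g s)"
  "c \<odot>\<^bsub>free_module K S\<^esub> f = (\<lambda>s. c \<otimes>\<^bsub>K\<^esub> f s)"
  by (simp_all add: free_module_def)

lemma module_free_module:
  assumes "cring K"
  shows "module K (free_module K S)"
proof -
  interpret K: cring K by fact
  \<comment> \<open>One support bound serves both operations: for a sum with two functions
    \<open>f\<close> and \<open>g\<close>, for a scalar multiple with \<open>g\<close> equal to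
    \<open>f\<close>.\<close>
  have supp: "finite {s. h s \<noteq> \<zero>\<^bsub>K\<^esub>} \<and> {s. h s \<noteq> \<zero>\<^bsub>K\<^esub>} \<subseteq> S"
    if "f \<in> carrier (free_module K S)" "g \<in> carrier (free_module K S)"
      "\<And>s. f s = \<zero>\<^bsub>K\<^esub> \<Longrightarrow> g s = \<zero>\<^bsub>K\<^esub> \<Longrightarrow> h s = \<zero>\<^bsub>K\<^esub>" for f g h
  proof -
    have "{s. h s \<noteq> \<zero>\<^bsub>K\<^esub>} \<subseteq> {s. f s \<noteq> \<zero>\<^bsub>K\<^esub>} \<union> {s. g s \<noteq> \<zero>\<^bsub>K\<^esub>}"
      using that(3) by blast
    with that(1,2) show ?thesis
      unfolding free_module_simps by (meson finite_UnI finite_subset le_sup_iff order_trans)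
  qed
  have closed_add: "f \<oplus>\<^bsub>free_module K S\<^esub> g \<in> carrier (free_module K S)"
    if "f \<in> carrier (free_module K S)" "g \<in> carrier (free_module K S)" for f g
    using supp[OF that, of "f \<oplus>\<^bsub>free_module K S\<^esub> g"] that by (auto simp: free_module_simps)
  have closed_smult: "c \<odot>\<^bsub>free_module K S\<^esub> f \<in> carrier (free_module K S)"
    if "c \<in> carrier K" "f \<in> carrier (free_module K S)" for c f
    using supp[OF that(2,2), of "c \<odot>\<^bsub>free_module K S\<^esub> f"] that by (auto simp: free_module_simps)
  show ?thesis
  proof (rule moduleI)
    show "abelian_group (free_module K S)"
    proof (rule abelian_groupI)
      fix f assume f: "f \<in> carrier (free_module K S)"
      \<comment> \<open>Taking (-1) f as the additive inverse gives its membership in the carrier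
        from \<open>closed_smult\<close>.\<close>
      have "(\<ominus>\<^bsub>K\<^esub> \<one>\<^bsub>K\<^esub>) \<odot>\<^bsub>free_module K S\<^esub> f \<oplus>\<^bsub>free_module K S\<^esub> f = \<zero>\<^bsub>free_module K S\<^esub>"
        using f by (auto simp: free_module_simps K.l_minus K.l_neg)
      then show "\<exists>g\<in>carrier (free_module K S). g \<oplus>\<^bsub>free_module K S\<^esub> f = \<zero>\<^bsub>free_module K S\<^esub>"
        using closed_smult[of "\<ominus>\<^bsub>K\<^esub> \<one>\<^bsub>K\<^esub>" f] f by auto
    qed (use closed_add in \<open>auto simp: free_module_simps K.a_ac\<close>)
  qed (use assms closed_smult in
      \<open>auto simp: free_module_simps K.l_distr K.r_distr K.m_assoc\<close>)
qed

lemma free_gen_closed: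
  assumes "cring K" "s \<in> S"
  shows "free_gen K s \<in> carrier (free_module K S)"
proof -
  interpret K: cring K by fact
  have "finite {t. free_gen K s t \<noteq> \<zero>\<^bsub>K\<^esub>}"
    by (rule finite_subset[of _ "{s}"]) (auto simp: free_gen_def)
  then show ?thesis
    using assms(2) by (auto simp: free_module_simps free_gen_def split: if_splits)
qed

text \<open>Supports are finite, so the induction is on their size: each step splits off the term of
  one basis element.\<close>

lemma free_module_induct [consumes 2, case_names zero step]:
  assumes "cring K" "f \<in> carrier (free_module K S)"
    and zero: "Q \<zero>\<^bsub>free_module K S\<^esub>"
    and step: "\<And>c s f. c \<in> carrier K \<Longrightarrow> s \<in> S \<Longrightarrow> f \<in> carrier (free_module K S) \<Longrightarrow> Q f \<Longrightarrow>
      Q (c \<odot>\<^bsub>free_module K S\<^esub> free_gen K s \<oplus>\<^bsub>free_module K S\<^esub> f)"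
  shows "Q f"
  using assms(2)
proof (induction "card {s. f s \<noteq> \<zero>\<^bsub>K\<^esub>}" arbitrary: f)
  case 0
  then have "f = \<zero>\<^bsub>free_module K S\<^esub>"
    by (auto simp: free_module_simps)
  then show ?case using zero by simp
next
  case (Suc n)
  interpret K: cring K by fact
  have fin: "finite {s. f s \<noteq> \<zero>\<^bsub>K\<^esub>}" and f: "\<And>s. f s \<in> carrier K"
    using Suc.prems by (auto simp: free_module_simps)
  from Suc.hyps(2) obtain s where s: "f s \<noteq> \<zero>\<^bsub>K\<^esub>"
    by (metis (mono_tags, lifting) Collect_empty_eq card.empty nat.distinct(1))
  \<comment> \<open>Erasing the value of \<open>f\<close> at \<open>s\<close> removes exactly
    \<open>s\<close> from the support, and \<open>f\<close> is recovered by adding back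
    \<open>f s\<close> times the generator at \<open>s\<close>.\<close>
  define g where "g = f(s := \<zero>\<^bsub>K\<^esub>)"
  have supp: "{t. g t \<noteq> \<zero>\<^bsub>K\<^esub>} = {t. f t \<noteq> \<zero>\<^bsub>K\<^esub>} - {s}"
    by (auto simp: g_def)
  have g: "g \<in> carrier (free_module K S)"
    using Suc.prems unfolding free_module_simps supp by (auto simp: g_def)
  moreover have "n = card {t. g t \<noteq> \<zero>\<^bsub>K\<^esub>}"
    unfolding supp using s fin Suc.hyps(2) by simp
  ultimately have "Q g" by (intro Suc.hyps(1))
  moreover have "f = f s \<odot>\<^bsub>free_module K S\<^esub> free_gen K s \<oplus>\<^bsub>free_module K S\<^esub> g"
    using f by (auto simp: free_module_simps free_gen_def g_def)
  moreover have "s \<in> S" using s Suc.prems by (auto simp: free_module_simps)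
  ultimately show ?case using step[OF f _ g] by metis
qed

text \<open>This is the sum inside \<open>tensor_lift\<close> before a representative is chosen, for
  an arbitrary index set in place of pairs.\<close>

definition free_lift ::
  "('k, 'r) ring_scheme \<Rightarrow> ('k, 'p, 'z) module_scheme \<Rightarrow> ('s \<Rightarrow> 'p) \<Rightarrow> ('s \<Rightarrow> 'k) \<Rightarrow> 'p" where
  "free_lift K P g f = (\<Oplus>\<^bsub>P\<^esub>s\<in>{s. f s \<noteq> \<zero>\<^bsub>K\<^esub>}. f s \<odot>\<^bsub>P\<^esub> g s)"

text \<open>Terms off the support are zero. The point of the larger \<open>T\<close> is that
  \<open>f\<close>, \<open>f'\<close> and their sum have different supports, and their lifts can be
  compared only over a common index set.\<close>

lemma free_lift_superset:
  assumes "module K P" "g \<in> S \<rightarrow> carrier P" "f \<in> carrier (free_module K S)"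
    and "finite T" "{s. f s \<noteq> \<zero>\<^bsub>K\<^esub>} \<subseteq> T" "T \<subseteq> S"
  shows "free_lift K P g f = (\<Oplus>\<^bsub>P\<^esub>s\<in>T. f s \<odot>\<^bsub>P\<^esub> g s)"
proof -
  interpret P: module K P by fact
  show ?thesis
    unfolding free_lift_def
  proof (rule P.add.finprod_mono_neutral_cong_left)
    show "(\<lambda>s. f s \<odot>\<^bsub>P\<^esub> g s) \<in> T \<rightarrow> carrier P"
      using assms(2,3,6) by (auto simp: free_module_simps)
    show "f s \<odot>\<^bsub>P\<^esub> g s = \<zero>\<^bsub>P\<^esub>" if "s \<in> T - {s. f s \<noteq> \<zero>\<^bsub>K\<^esub>}" for s
      using assms(2,6) that by (auto simp: Pi_iff subset_iff)
  qed (use assms(4,5) in auto)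
qed

lemma free_lift_linear:
  assumes "module K P" "g \<in> S \<rightarrow> carrier P"
  shows "free_lift K P g \<in> linear_maps K (free_module K S) P"
proof -
  interpret P: module K P by fact
  let ?F = "free_module K S"
  interpret F: module K ?F by (rule module_free_module) unfold_locales
  have closed: "f s \<odot>\<^bsub>P\<^esub> g s \<in> carrier P" if "f \<in> carrier ?F" "s \<in> S" for f s
    using assms(2) that by (auto simp: free_module_simps)
  have supp: "finite {s. f s \<noteq> \<zero>\<^bsub>K\<^esub>}" "{s. f s \<noteq> \<zero>\<^bsub>K\<^esub>} \<subseteq> S" "\<And>s. f s \<in> carrier K"
    if "f \<in> carrier ?F" for f
    using that by (auto simp: free_module_simps)
  show ?thesis
  proof (rule linear_mapsI)
    show "free_lift K P g f \<in> carrier P" if "f \<in> carrier ?F" for f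
      unfolding free_lift_def using that by (intro P.finsum_closed) (use closed supp(2) in auto)
  next
    fix f f' assume f: "f \<in> carrier ?F" and f': "f' \<in> carrier ?F"
    define T where "T = {s. f s \<noteq> \<zero>\<^bsub>K\<^esub>} \<union> {s. f' s \<noteq> \<zero>\<^bsub>K\<^esub>}"
    have T: "finite T" "T \<subseteq> S"
      using supp[OF f] supp[OF f'] by (auto simp: T_def)
    have "free_lift K P g (f \<oplus>\<^bsub>?F\<^esub> f') = (\<Oplus>\<^bsub>P\<^esub>s\<in>T. (f \<oplus>\<^bsub>?F\<^esub> f') s \<odot>\<^bsub>P\<^esub> g s)"
      using F.a_closed[OF f f'] T
      by (intro free_lift_superset[OF assms]) (auto simp: T_def free_module_simps(3))
    also have "\<dots> = (\<Oplus>\<^bsub>P\<^esub>s\<in>T. f s \<odot>\<^bsub>P\<^esub> g s \<oplus>\<^bsub>P\<^esub> f' s \<odot>\<^bsub>P\<^esub> g s)"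
      using assms(2) T(2) f f' supp(3) closed
      by (intro P.finsum_cong) (auto simp: free_module_simps(3) P.smult_l_distr simp_implies_def Pi_def subset_iff)
    also have "\<dots> = (\<Oplus>\<^bsub>P\<^esub>s\<in>T. f s \<odot>\<^bsub>P\<^esub> g s) \<oplus>\<^bsub>P\<^esub> (\<Oplus>\<^bsub>P\<^esub>s\<in>T. f' s \<odot>\<^bsub>P\<^esub> g s)"
      using T(2) closed[OF f] closed[OF f'] by (intro P.finsum_addf) auto
    also have "\<dots> = free_lift K P g f \<oplus>\<^bsub>P\<^esub> free_lift K P g f'"
      using T unfolding T_def
      by (simp add: free_lift_superset[OF assms f, of T] free_lift_superset[OF assms f', of T] T_def)
    finally show "free_lift K P g (f \<oplus>\<^bsub>?F\<^esub> f') = free_lift K P g f \<oplus>\<^bsub>P\<^esub> free_lift K P g f'" .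
  next
    fix c f assume c: "c \<in> carrier K" and f: "f \<in> carrier ?F"
    \<comment> \<open>Multiplying by \<open>c\<close> may shrink the support, so both sides are
      summed over the support of \<open>f\<close>.\<close>
    let ?T = "{s. f s \<noteq> \<zero>\<^bsub>K\<^esub>}"
    have "free_lift K P g (c \<odot>\<^bsub>?F\<^esub> f) = (\<Oplus>\<^bsub>P\<^esub>s\<in>?T. (c \<odot>\<^bsub>?F\<^esub> f) s \<odot>\<^bsub>P\<^esub> g s)"
      using c F.smult_closed[OF c f] supp[OF f]
      by (intro free_lift_superset[OF assms]) (auto simp: free_module_simps(4))
    also have "\<dots> = (\<Oplus>\<^bsub>P\<^esub>s\<in>?T. c \<odot>\<^bsub>P\<^esub> (f s \<odot>\<^bsub>P\<^esub> g s))"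
      using assms(2) c f supp[OF f] closed[OF f]
      by (intro P.finsum_cong) (auto simp: free_module_simps(4) P.smult_assoc1 simp_implies_def Pi_def subset_iff)
    also have "\<dots> = c \<odot>\<^bsub>P\<^esub> free_lift K P g f"
      unfolding free_lift_def
      using c supp[OF f] closed[OF f] by (intro P.finsum_smult_ldistr[symmetric]) auto
    finally show "free_lift K P g (c \<odot>\<^bsub>?F\<^esub> f) = c \<odot>\<^bsub>P\<^esub> free_lift K P g f" .
  qed
qed

lemma free_lift_gen:
  assumes "module K P" "g \<in> S \<rightarrow> carrier P" "s \<in> S"
  shows "free_lift K P g (free_gen K s) = g s"
proof -
  interpret P: module K P by fact
  \<comment> \<open>Summing over {s} also covers the zero ring, where the generator has empty
    support.\<close>
  have "free_lift K P g (free_gen K s) = (\<Oplus>\<^bsub>P\<^esub>t\<in>{s}. free_gen K s t \<odot>\<^bsub>P\<^esub> g t)"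
    using assms free_gen_closed[OF P.R.cring_axioms assms(3)]
    by (intro free_lift_superset[OF assms(1,2)]) (auto simp: free_gen_def)
  then show ?thesis
    using assms(2,3) by (simp add: P.finsum_insert free_gen_def Pi_iff)
qed

section \<open>Generated submodules and quotient modules\<close>

lemma generated_submodule_submodule:
  assumes "module K M" "S \<subseteq> carrier M"
  shows "submodule (generated_submodule K M S) K M"
proof -
  interpret M: module K M by fact
  \<comment> \<open>The whole module is one of the submodules being intersected, so the family is
    not empty.\<close>
  have "generated_submodule K M S \<subseteq> carrier M"
    using M.carrier_is_submodule assms(2) by (auto simp: generated_submodule_def)
  then show ?thesis
    by (intro M.submoduleI)
      (auto simp: generated_submodule_def M.submoduleE submodule.smult_closed
        dest: subgroup.one_closed[OF submodule.axioms(1)])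
qed

lemma generated_submodule_superset: "S \<subseteq> generated_submodule K M S"
  by (auto simp: generated_submodule_def)

lemma generated_submodule_least:
  "submodule H K M \<Longrightarrow> S \<subseteq> H \<Longrightarrow> generated_submodule K M S \<subseteq> H"
  by (auto simp: generated_submodule_def)

lemma (in module) abelian_subgroup_submodule:
  "submodule H R M \<Longrightarrow> abelian_subgroup H M"
  using abelian_subgroupI3 additive_subgroupI submodule.axioms(1) M.abelian_group_axioms by blast

lemma quotient_module_simps:
  "carrier (quotient_module M H) = a_rcosets\<^bsub>M\<^esub> H"
  "\<zero>\<^bsub>quotient_module M H\<^esub> = H"
  "C \<oplus>\<^bsub>quotient_module M H\<^esub> D = C <+>\<^bsub>M\<^esub> D"
  by (simp_all add: quotient_module_def)

lemma coset_eq_iff: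
  assumes "module K M" "submodule H K M" "x \<in> carrier M" "y \<in> carrier M"
  shows "H +>\<^bsub>M\<^esub> x = H +>\<^bsub>M\<^esub> y \<longleftrightarrow> x \<ominus>\<^bsub>M\<^esub> y \<in> H"
proof -
  interpret M: module K M by fact
  interpret H: abelian_subgroup H M by (rule M.abelian_subgroup_submodule[OF assms(2)])
  have "H +>\<^bsub>M\<^esub> x = H +>\<^bsub>M\<^esub> y \<longleftrightarrow> x \<in> H +>\<^bsub>M\<^esub> y"
    by (metis H.a_rcos_self H.a_repr_independence' assms(3,4))
  also have "\<dots> \<longleftrightarrow> x \<ominus>\<^bsub>M\<^esub> y \<in> H"
    using H.a_rcos_module[of y x] assms(3,4) by (simp add: a_minus_def)
  finally show ?thesis .
qed

text \<open>The scalar action on a coset is a union over all its representatives. Two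
  representatives differ by an element of \<open>H\<close>, which is stable under scalars, so all
  the cosets in that union coincide.\<close>

lemma quotient_smult_coset:
  assumes "module K M" "submodule H K M" "c \<in> carrier K" "x \<in> carrier M"
  shows "c \<odot>\<^bsub>quotient_module M H\<^esub> (H +>\<^bsub>M\<^esub> x) = H +>\<^bsub>M\<^esub> (c \<odot>\<^bsub>M\<^esub> x)"
proof -
  interpret M: module K M by fact
  interpret H: abelian_subgroup H M by (rule M.abelian_subgroup_submodule[OF assms(2)])
  have "H +>\<^bsub>M\<^esub> (c \<odot>\<^bsub>M\<^esub> y) = H +>\<^bsub>M\<^esub> (c \<odot>\<^bsub>M\<^esub> x)" if "y \<in> H +>\<^bsub>M\<^esub> x" for y
  proof -
    have y: "y \<in> carrier M"
      using that M.a_r_coset_subset_G[OF H.a_subset assms(4)] by blast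
    have "y \<ominus>\<^bsub>M\<^esub> x \<in> H"
      using H.a_rcos_module[of x y] that y assms(4) by (simp add: a_minus_def)
    then have "c \<odot>\<^bsub>M\<^esub> (y \<ominus>\<^bsub>M\<^esub> x) \<in> H"
      using submodule.smult_closed[OF assms(2,3)] by blast
    then show ?thesis
      using y assms(3,4)
      by (subst coset_eq_iff[OF assms(1,2)])
        (auto simp: a_minus_def M.smult_r_distr M.smult_r_minus)
  qed
  \<comment> \<open>Nonemptiness of the coset matters: the union of a constant family over the empty
    set would be empty.\<close>
  moreover have "x \<in> H +>\<^bsub>M\<^esub> x" by (rule H.a_rcos_self[OF assms(4)])
  ultimately have "(\<Union>y\<in>H +>\<^bsub>M\<^esub> x. H +>\<^bsub>M\<^esub> (c \<odot>\<^bsub>M\<^esub> y)) = H +>\<^bsub>M\<^esub> (c \<odot>\<^bsub>M\<^esub> x)"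
    by (intro UN_constant_eq) blast+
  then show ?thesis by (simp add: quotient_module_def)
qed

lemma coset_map_linear:
  assumes "module K M" "submodule H K M"
  shows "(\<lambda>x. H +>\<^bsub>M\<^esub> x) \<in> linear_maps K M (quotient_module M H)"
proof -
  interpret M: module K M by fact
  interpret H: abelian_subgroup H M by (rule M.abelian_subgroup_submodule[OF assms(2)])
  show ?thesis
    by (intro linear_mapsI)
      (auto simp: quotient_smult_coset[OF assms] quotient_module_simps H.a_rcos_sum
        intro: M.a_rcosetsI[OF H.a_subset])
qed

lemma quotient_module_cases:
  assumes "C \<in> carrier (quotient_module M H)"
  obtains x where "x \<in> carrier M" "C = H +>\<^bsub>M\<^esub> x"
  using assms by (auto simp: quotient_module_simps A_RCOSETS_def')

text \<open>The projection \<open>?p\<close> is onto and respects the operations, so every module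
  axiom is inherited from \<open>M\<close> by choosing representatives.\<close>

lemma module_quotient_module:
  assumes "module K M" "submodule H K M"
  shows "module K (quotient_module M H)"
proof -
  let ?Q = "quotient_module M H" and ?p = "\<lambda>x. H +>\<^bsub>M\<^esub> x"
  interpret M: module K M by fact
  interpret H: abelian_subgroup H M by (rule M.abelian_subgroup_submodule[OF assms(2)])
  note p = coset_map_linear[OF assms]
  have add: "?p x \<oplus>\<^bsub>?Q\<^esub> ?p y = ?p (x \<oplus>\<^bsub>M\<^esub> y)" if "x \<in> carrier M" "y \<in> carrier M" for x y
    using linear_maps_add[OF p that] by simp
  have smult: "c \<odot>\<^bsub>?Q\<^esub> ?p x = ?p (c \<odot>\<^bsub>M\<^esub> x)" if "c \<in> carrier K" "x \<in> carrier M" for c x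
    using linear_maps_smult[OF p that] by simp
  have zero: "\<zero>\<^bsub>?Q\<^esub> = ?p \<zero>\<^bsub>M\<^esub>"
    by (simp add: quotient_module_simps M.a_coset_add_zero H.a_subset)
  have closed: "?p x \<in> carrier ?Q" if "x \<in> carrier M" for x
    using linear_maps_closed[OF p that] .
  show ?thesis
  proof (intro moduleI M.R.cring_axioms abelian_groupI)
    show "\<zero>\<^bsub>?Q\<^esub> \<in> carrier ?Q" using zero closed by simp
  next
    fix C assume "C \<in> carrier ?Q"
    then obtain x where x: "x \<in> carrier M" "C = ?p x" by (rule quotient_module_cases)
    have "?p (\<ominus>\<^bsub>M\<^esub> x) \<oplus>\<^bsub>?Q\<^esub> C = \<zero>\<^bsub>?Q\<^esub>"
      using x by (simp add: add zero M.l_neg)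
    then show "\<exists>D\<in>carrier ?Q. D \<oplus>\<^bsub>?Q\<^esub> C = \<zero>\<^bsub>?Q\<^esub>"
      using x closed by blast
    show "\<zero>\<^bsub>?Q\<^esub> \<oplus>\<^bsub>?Q\<^esub> C = C" "\<one>\<^bsub>K\<^esub> \<odot>\<^bsub>?Q\<^esub> C = C"
      using x by (simp_all add: zero add smult)
    fix c assume c: "c \<in> carrier K"
    show "c \<odot>\<^bsub>?Q\<^esub> C \<in> carrier ?Q" using c x by (simp add: smult closed)
    fix d assume d: "d \<in> carrier K"
    show "(c \<oplus>\<^bsub>K\<^esub> d) \<odot>\<^bsub>?Q\<^esub> C = c \<odot>\<^bsub>?Q\<^esub> C \<oplus>\<^bsub>?Q\<^esub> d \<odot>\<^bsub>?Q\<^esub> C"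
      using c d x by (simp add: smult add M.smult_l_distr)
    show "(c \<otimes>\<^bsub>K\<^esub> d) \<odot>\<^bsub>?Q\<^esub> C = c \<odot>\<^bsub>?Q\<^esub> (d \<odot>\<^bsub>?Q\<^esub> C)"
      using c d x by (simp add: smult M.smult_assoc1)
  next
    fix C D assume "C \<in> carrier ?Q" "D \<in> carrier ?Q"
    then obtain x y where xy: "x \<in> carrier M" "y \<in> carrier M" "C = ?p x" "D = ?p y"
      by (metis quotient_module_cases)
    show "C \<oplus>\<^bsub>?Q\<^esub> D \<in> carrier ?Q" using xy by (simp add: add closed)
    show "C \<oplus>\<^bsub>?Q\<^esub> D = D \<oplus>\<^bsub>?Q\<^esub> C" using xy by (simp add: add M.a_comm)
    show "c \<odot>\<^bsub>?Q\<^esub> (C \<oplus>\<^bsub>?Q\<^esub> D) = c \<odot>\<^bsub>?Q\<^esub> C \<oplus>\<^bsub>?Q\<^esub> c \<odot>\<^bsub>?Q\<^esub> D" if "c \<in> carrier K" for c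
      using that xy by (simp add: smult add M.smult_r_distr)
    fix E assume "E \<in> carrier ?Q"
    then obtain z where "z \<in> carrier M" "E = ?p z" by (rule quotient_module_cases)
    then show "C \<oplus>\<^bsub>?Q\<^esub> D \<oplus>\<^bsub>?Q\<^esub> E = C \<oplus>\<^bsub>?Q\<^esub> (D \<oplus>\<^bsub>?Q\<^esub> E)"
      using xy by (simp add: add M.a_assoc)
  qed
qed


section \<open>Tensor products\<close>

lemma bilinear_relators_closed:
  assumes "module K M" "module K N"
  shows "bilinear_relators K M N \<subseteq> carrier (free_module K (carrier M \<times> carrier N))"
proof -
  interpret M: module K M by fact
  interpret N: module K N by fact
  interpret F: module K "free_module K (carrier M \<times> carrier N)"
    by (rule module_free_module) unfold_locales
  show ?thesis
    by (auto simp: bilinear_relators_def Let_def free_gen_closed[OF M.R.cring_axioms])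
qed

lemma submodule_tensor_relations:
  assumes "module K M" "module K N"
  shows "submodule (tensor_relations K M N) K (free_module K (carrier M \<times> carrier N))"
  unfolding tensor_relations_def
  using assms module.axioms(1)
  by (intro generated_submodule_submodule bilinear_relators_closed module_free_module)

lemma module_tensor:
  assumes "module K M" "module K N"
  shows "module K (tensor K M N)"
  unfolding tensor_def
  using assms module.axioms(1)
  by (intro module_quotient_module submodule_tensor_relations module_free_module)

lemma bilinear_pure_tensor:
  assumes "module K M" "module K N"
  shows "bilinear K M N (tensor K M N) (pure_tensor K M N)"
proof -
  let ?F = "free_module K (carrier M \<times> carrier N)" and ?H = "tensor_relations K M N"
  let ?e = "\<lambda>m n. free_gen K (m, n)"
  interpret M: module K M by fact
  interpret N: module K N by fact
  interpret F: module K ?F by (rule module_free_module) unfold_locales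
  have e [simp]: "?e m n \<in> carrier ?F" if "m \<in> carrier M" "n \<in> carrier N" for m n
    using that by (intro free_gen_closed M.R.cring_axioms) auto
  note H = submodule_tensor_relations[OF assms]
  note p = coset_map_linear[OF F.module_axioms H, folded tensor_def]
  \<comment> \<open>Each bilinearity law equates two cosets whose representatives differ by one of
    the four kinds of relators.\<close>
  have rel: "?H +>\<^bsub>?F\<^esub> x = ?H +>\<^bsub>?F\<^esub> y"
    if "x \<ominus>\<^bsub>?F\<^esub> y \<in> bilinear_relators K M N" "x \<in> carrier ?F" "y \<in> carrier ?F" for x y
    using coset_eq_iff[OF F.module_axioms H that(2,3)] that(1)
      generated_submodule_superset[of "bilinear_relators K M N" K ?F, folded tensor_relations_def]
    by blast
  have add_left: "?e (m \<oplus>\<^bsub>M\<^esub> m') n \<ominus>\<^bsub>?F\<^esub> (?e m n \<oplus>\<^bsub>?F\<^esub> ?e m' n) \<in> bilinear_relators K M N"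
    if "m \<in> carrier M" "m' \<in> carrier M" "n \<in> carrier N" for m m' n
    using that unfolding bilinear_relators_def Let_def by blast
  have add_right: "?e m (n \<oplus>\<^bsub>N\<^esub> n') \<ominus>\<^bsub>?F\<^esub> (?e m n \<oplus>\<^bsub>?F\<^esub> ?e m n') \<in> bilinear_relators K M N"
    if "m \<in> carrier M" "n \<in> carrier N" "n' \<in> carrier N" for m n n'
    using that unfolding bilinear_relators_def Let_def by blast
  have smult_left: "?e (c \<odot>\<^bsub>M\<^esub> m) n \<ominus>\<^bsub>?F\<^esub> (c \<odot>\<^bsub>?F\<^esub> ?e m n) \<in> bilinear_relators K M N"
    if "c \<in> carrier K" "m \<in> carrier M" "n \<in> carrier N" for c m n
    using that unfolding bilinear_relators_def Let_def by blast
  have smult_right: "?e m (c \<odot>\<^bsub>N\<^esub> n) \<ominus>\<^bsub>?F\<^esub> (c \<odot>\<^bsub>?F\<^esub> ?e m n) \<in> bilinear_relators K M N"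
    if "c \<in> carrier K" "m \<in> carrier M" "n \<in> carrier N" for c m n
    using that unfolding bilinear_relators_def Let_def by blast
  have closed: "pure_tensor K M N m n \<in> carrier (tensor K M N)"
    if "m \<in> carrier M" "n \<in> carrier N" for m n
    unfolding pure_tensor_def using linear_maps_closed[OF p e[OF that]] .
  show ?thesis
    by (intro bilinearI linear_mapsI closed)
      (simp_all add: pure_tensor_def linear_maps_add[OF p, symmetric]
        linear_maps_smult[OF p, symmetric] rel add_left add_right smult_left smult_right)
qed

lemmas pure_tensor_closed = bilinear_closed[OF bilinear_pure_tensor]

text \<open>No case for scalars or for zero is needed: c (m (x) n) = m (x) (c n) and 0 = 0 (x) 0 are
  themselves pure tensors. So pure tensors generate under addition alone.\<close>

lemma tensor_induct [consumes 3, case_names pure add]: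
  assumes "t \<in> carrier (tensor K M N)" "module K M" "module K N"
    and pure: "\<And>m n. m \<in> carrier M \<Longrightarrow> n \<in> carrier N \<Longrightarrow> Q (pure_tensor K M N m n)"
    and add: "\<And>s t. s \<in> carrier (tensor K M N) \<Longrightarrow> t \<in> carrier (tensor K M N) \<Longrightarrow>
      Q s \<Longrightarrow> Q t \<Longrightarrow> Q (s \<oplus>\<^bsub>tensor K M N\<^esub> t)"
  shows "Q t"
proof -
  let ?F = "free_module K (carrier M \<times> carrier N)" and ?H = "tensor_relations K M N"
  let ?T = "tensor K M N"
  interpret M: module K M by fact
  interpret N: module K N by fact
  interpret F: module K ?F by (rule module_free_module) unfold_locales
  interpret T: module K ?T by (rule module_tensor[OF assms(2,3)])
  note gen = free_gen_closed[OF M.R.cring_axioms]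
  note p = coset_map_linear[OF F.module_axioms submodule_tensor_relations[OF assms(2,3)],
      folded tensor_def]
  obtain f where f: "f \<in> carrier ?F" "t = ?H +>\<^bsub>?F\<^esub> f"
    using assms(1) unfolding tensor_def by (rule quotient_module_cases)
  have "Q (?H +>\<^bsub>?F\<^esub> f)"
    using M.R.cring_axioms f(1)
  proof (induction rule: free_module_induct)
    case zero
    have "?H +>\<^bsub>?F\<^esub> \<zero>\<^bsub>?F\<^esub> = pure_tensor K M N \<zero>\<^bsub>M\<^esub> \<zero>\<^bsub>N\<^esub>"
      using linear_maps_zero[OF p F.module_axioms T.module_axioms]
        linear_maps_zero[OF bilinear_right[OF bilinear_pure_tensor[OF assms(2,3)] M.zero_closed]
          assms(3) T.module_axioms] by simp
    then show ?case using pure[OF M.zero_closed N.zero_closed] by simp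
  next
    case (step c s f)
    obtain m n where s: "s = (m, n)" "m \<in> carrier M" "n \<in> carrier N"
      using step(2) by auto
    have "?H +>\<^bsub>?F\<^esub> (c \<odot>\<^bsub>?F\<^esub> free_gen K s) = c \<odot>\<^bsub>?T\<^esub> pure_tensor K M N m n"
      unfolding pure_tensor_def s(1) using step(1) s by (intro linear_maps_smult[OF p] gen) auto
    also have "\<dots> = pure_tensor K M N m (c \<odot>\<^bsub>N\<^esub> n)"
      using linear_maps_smult[OF bilinear_right[OF bilinear_pure_tensor[OF assms(2,3)] s(2)]
          step(1) s(3)] by simp
    finally have "?H +>\<^bsub>?F\<^esub> (c \<odot>\<^bsub>?F\<^esub> free_gen K s \<oplus>\<^bsub>?F\<^esub> f) =
        pure_tensor K M N m (c \<odot>\<^bsub>N\<^esub> n) \<oplus>\<^bsub>?T\<^esub> (?H +>\<^bsub>?F\<^esub> f)"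
      using step(1-3) by (subst linear_maps_add[OF p]) (auto intro: gen)
    moreover have "Q (pure_tensor K M N m (c \<odot>\<^bsub>N\<^esub> n) \<oplus>\<^bsub>?T\<^esub> (?H +>\<^bsub>?F\<^esub> f))"
      using step s
      by (intro add pure pure_tensor_closed[OF assms(2,3)] linear_maps_closed[OF p]) auto
    ultimately show ?case by simp
  qed
  then show ?thesis using f(2) by simp
qed

text \<open>This is the independence from the representative. The linear extension \<open>?L\<close>
  of \<open>\<beta>\<close> kills the relators because \<open>\<beta>\<close> is bilinear, hence
  kills the submodule \<open>?H\<close> they generate, and any two representatives differ by an
  element of \<open>?H\<close>.\<close>

lemma tensor_lift_coset:
  assumes "module K M" "module K N" "module K P" "bilinear K M N P \<beta>"
    and "f \<in> carrier (free_module K (carrier M \<times> carrier N))"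
  shows "tensor_lift K P \<beta> (tensor_relations K M N +>\<^bsub>free_module K (carrier M \<times> carrier N)\<^esub> f) =
    free_lift K P (\<lambda>s. \<beta> (fst s) (snd s)) f"
proof -
  let ?F = "free_module K (carrier M \<times> carrier N)" and ?H = "tensor_relations K M N"
  let ?L = "free_lift K P (\<lambda>s. \<beta> (fst s) (snd s))"
  interpret M: module K M by fact
  interpret N: module K N by fact
  interpret P: module K P by fact
  interpret F: module K ?F by (rule module_free_module) unfold_locales
  note H = submodule_tensor_relations[OF assms(1,2)]
  interpret H: abelian_subgroup ?H ?F by (rule F.abelian_subgroup_submodule[OF H])
  have gen: "free_gen K (m, n) \<in> carrier ?F" if "m \<in> carrier M" "n \<in> carrier N" for m n
    using that by (intro free_gen_closed M.R.cring_axioms) auto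
  have minus_self: "x \<ominus>\<^bsub>P\<^esub> x = \<zero>\<^bsub>P\<^esub>" if "x \<in> carrier P" for x
    using that by (simp add: a_minus_def P.r_neg)
  have \<beta>: "(\<lambda>s. \<beta> (fst s) (snd s)) \<in> carrier M \<times> carrier N \<rightarrow> carrier P"
    using bilinear_closed[OF assms(4)] by auto
  note L = free_lift_linear[OF assms(3) \<beta>]
  note L_minus = linear_maps_minus[OF L F.module_axioms assms(3)]
  have L_gen: "?L (free_gen K (m, n)) = \<beta> m n" if "m \<in> carrier M" "n \<in> carrier N" for m n
    using free_lift_gen[OF assms(3) \<beta>, of "(m, n)"] that by simp
  have "bilinear_relators K M N \<subseteq> {f \<in> carrier ?F. ?L f = \<zero>\<^bsub>P\<^esub>}"
  proof
    fix x assume x: "x \<in> bilinear_relators K M N"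
    then have "?L x = \<zero>\<^bsub>P\<^esub>"
      unfolding bilinear_relators_def Let_def
      by (auto simp: L_minus gen linear_maps_add[OF L] linear_maps_smult[OF L] L_gen
          linear_mapsD[OF bilinear_right[OF assms(4)]] linear_mapsD[OF bilinear_left[OF assms(4)]] minus_self)
    then show "x \<in> {f \<in> carrier ?F. ?L f = \<zero>\<^bsub>P\<^esub>}"
      using x bilinear_relators_closed[OF assms(1,2)] by blast
  qed
  then have ker: "?H \<subseteq> {f \<in> carrier ?F. ?L f = \<zero>\<^bsub>P\<^esub>}"
    unfolding tensor_relations_def
    by (intro generated_submodule_least submodule_kernel L F.module_axioms assms(3))
  \<comment> \<open>The very representative that \<open>tensor_lift\<close> selects; it is
    \<open>f\<close> shifted by some \<open>h\<close> in \<open>?H\<close>.\<close>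
  define g where "g = (SOME g. g \<in> ?H +>\<^bsub>?F\<^esub> f)"
  have "g \<in> ?H +>\<^bsub>?F\<^esub> f"
    unfolding g_def by (rule someI[of "\<lambda>g. g \<in> ?H +>\<^bsub>?F\<^esub> f"], rule H.a_rcos_self[OF assms(5)])
  then have "\<exists>h\<in>?H. g = h \<oplus>\<^bsub>?F\<^esub> f"
    by (auto simp: a_r_coset_def')
  then obtain h where h: "h \<in> ?H" "g = h \<oplus>\<^bsub>?F\<^esub> f" ..
  have "?L g = ?L f"
    using h ker assms(5) by (auto simp: linear_mapsD[OF L])
  moreover have "tensor_lift K P \<beta> (?H +>\<^bsub>?F\<^esub> f) = ?L g"
    unfolding tensor_lift_def g_def[symmetric] by (simp add: free_lift_def)
  ultimately show ?thesis by simp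
qed

lemma tensor_lift_linear:
  assumes "module K M" "module K N" "module K P" "bilinear K M N P \<beta>"
  shows "tensor_lift K P \<beta> \<in> linear_maps K (tensor K M N) P"
proof -
  let ?F = "free_module K (carrier M \<times> carrier N)" and ?H = "tensor_relations K M N"
  let ?p = "\<lambda>f. ?H +>\<^bsub>?F\<^esub> f"
  interpret M: module K M by fact
  interpret F: module K ?F by (rule module_free_module) unfold_locales
  note p = coset_map_linear[OF F.module_axioms submodule_tensor_relations[OF assms(1,2)],
      folded tensor_def]
  have \<beta>: "(\<lambda>s. \<beta> (fst s) (snd s)) \<in> carrier M \<times> carrier N \<rightarrow> carrier P"
    using bilinear_closed[OF assms(4)] by auto
  note L = free_lift_linear[OF assms(3) \<beta>]
  have cases: "\<exists>f\<in>carrier ?F. t = ?p f" if "t \<in> carrier (tensor K M N)" for t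
    using that unfolding tensor_def by (metis quotient_module_cases)
  show ?thesis
  proof (rule linear_mapsI)
    show "tensor_lift K P \<beta> t \<in> carrier P" if "t \<in> carrier (tensor K M N)" for t
      using cases[OF that] by (auto simp: tensor_lift_coset[OF assms] linear_maps_closed[OF L])
  next
    fix s t assume "s \<in> carrier (tensor K M N)" "t \<in> carrier (tensor K M N)"
    then obtain f g where "f \<in> carrier ?F" "s = ?p f" "g \<in> carrier ?F" "t = ?p g"
      using cases by meson
    then show "tensor_lift K P \<beta> (s \<oplus>\<^bsub>tensor K M N\<^esub> t) =
        tensor_lift K P \<beta> s \<oplus>\<^bsub>P\<^esub> tensor_lift K P \<beta> t"
      by (simp add: linear_maps_add[OF p, symmetric] tensor_lift_coset[OF assms]
          linear_maps_add[OF L])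
  next
    fix c t assume "c \<in> carrier K" "t \<in> carrier (tensor K M N)"
    moreover from this(2) obtain f where "f \<in> carrier ?F" "t = ?p f"
      using cases by meson
    ultimately show "tensor_lift K P \<beta> (c \<odot>\<^bsub>tensor K M N\<^esub> t) = c \<odot>\<^bsub>P\<^esub> tensor_lift K P \<beta> t"
      by (simp add: linear_maps_smult[OF p, symmetric] tensor_lift_coset[OF assms]
          linear_maps_smult[OF L])
  qed
qed

lemma tensor_lift_pure:
  assumes "module K M" "module K N" "module K P" "bilinear K M N P \<beta>"
    and "m \<in> carrier M" "n \<in> carrier N"
  shows "tensor_lift K P \<beta> (pure_tensor K M N m n) = \<beta> m n"
proof -
  have \<beta>: "(\<lambda>s. \<beta> (fst s) (snd s)) \<in> carrier M \<times> carrier N \<rightarrow> carrier P"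
    using bilinear_closed[OF assms(4)] by auto
  have "free_gen K (m, n) \<in> carrier (free_module K (carrier M \<times> carrier N))"
    using assms(1,5,6) by (intro free_gen_closed) (auto dest: module.axioms(1))
  then show ?thesis
    unfolding pure_tensor_def
    using free_lift_gen[OF assms(3) \<beta>, of "(m, n)"] assms(5,6)
    by (simp add: tensor_lift_coset[OF assms(1-4)])
qed

text \<open>By \<open>tensor_induct\<close>, additivity carries agreement from pure tensors to their
  sums. All later identities between maps on A (x) B are proved this way, also when they are wanted
  at a single tensor such as a value of R.\<close>

lemma linear_maps_tensor_eqI:
  assumes "f \<in> linear_maps K (tensor K M N) P" "g \<in> linear_maps K (tensor K M N) P"
    and "module K M" "module K N"
    and "\<And>m n. m \<in> carrier M \<Longrightarrow> n \<in> carrier N \<Longrightarrow>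
      f (pure_tensor K M N m n) = g (pure_tensor K M N m n)"
    and "t \<in> carrier (tensor K M N)"
  shows "f t = g t"
  using assms(6,3,4)
  by (induction rule: tensor_induct)
    (simp_all add: assms(5) linear_maps_add[OF assms(1)] linear_maps_add[OF assms(2)])

text \<open>Rebracketing maps are lifts of lifts: the outer lift requires the inner one, at a fixed
  tensor \<open>t\<close>, to be linear in the remaining variable \<open>q\<close>. For pure
  \<open>t\<close> this is linearity of \<open>\<beta> q m n\<close> in \<open>q\<close>, and sums
  in \<open>t\<close> become pointwise sums of linear maps.\<close>

lemma tensor_lift_linear_parameter:
  assumes "module K M" "module K N" "module K P" "module K Q"
    and "\<And>q. q \<in> carrier Q \<Longrightarrow> bilinear K M N P (\<beta> q)"
    and "\<And>m n. m \<in> carrier M \<Longrightarrow> n \<in> carrier N \<Longrightarrow> (\<lambda>q. \<beta> q m n) \<in> linear_maps K Q P"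
    and "t \<in> carrier (tensor K M N)"
  shows "(\<lambda>q. tensor_lift K P (\<beta> q) t) \<in> linear_maps K Q P"
  using assms(7,1,2)
proof (induction rule: tensor_induct)
  case (pure m n)
  then show ?case
    by (intro linear_maps_cong[OF assms(6) assms(4)])
      (auto simp: tensor_lift_pure[OF assms(1-3) assms(5)])
next
  case (add s t)
  then show ?case
    by (intro linear_maps_cong[OF linear_maps_pointwise_add[OF add(3,4) assms(3)] assms(4)])
      (auto intro: linear_maps_add[OF tensor_lift_linear[OF assms(1-3) assms(5)]])
qed

section \<open>Tensor products of maps and the rebracketing maps\<close>

lemma tensor_map_bilinear:
  assumes "module K P" "module K Q" "f \<in> linear_maps K M P" "g \<in> linear_maps K N Q"
  shows "bilinear K M N (tensor K P Q) (\<lambda>m n. pure_tensor K P Q (f m) (g n))"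
  by (intro bilinear_comp_linear[OF bilinear_pure_tensor] assms)

lemma tensor_map_linear:
  assumes "module K M" "module K N" "module K P" "module K Q"
    and "f \<in> linear_maps K M P" "g \<in> linear_maps K N Q"
  shows "tensor_map K P Q f g \<in> linear_maps K (tensor K M N) (tensor K P Q)"
  unfolding tensor_map_def by (intro tensor_lift_linear module_tensor tensor_map_bilinear assms)

lemma tensor_map_pure:
  assumes "module K M" "module K N" "module K P" "module K Q"
    and "f \<in> linear_maps K M P" "g \<in> linear_maps K N Q" "m \<in> carrier M" "n \<in> carrier N"
  shows "tensor_map K P Q f g (pure_tensor K M N m n) = pure_tensor K P Q (f m) (g n)"
  unfolding tensor_map_def by (intro tensor_lift_pure module_tensor tensor_map_bilinear assms)

text \<open>The two conclusions are the bilinearity conditions of the inner and of the outer lift in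
  \<open>tensor_assoc\<close>.\<close>

lemma tensor_assoc_bilinear:
  assumes "module K M" "module K N" "module K P"
  defines "T \<equiv> tensor K M (tensor K N P)"
  shows "p \<in> carrier P \<Longrightarrow>
      bilinear K M N T (\<lambda>m n. pure_tensor K M (tensor K N P) m (pure_tensor K N P n p))"
    and "bilinear K (tensor K M N) P T (\<lambda>t p. tensor_lift K T
      (\<lambda>m n. pure_tensor K M (tensor K N P) m (pure_tensor K N P n p)) t)"
proof -
  let ?\<beta> = "\<lambda>p m n. pure_tensor K M (tensor K N P) m (pure_tensor K N P n p)"
  note NP = module_tensor[OF assms(2,3)]
  have T: "module K T" unfolding T_def by (intro module_tensor assms(1) NP)
  show \<beta>: "bilinear K M N T (?\<beta> p)" if "p \<in> carrier P" for p
    unfolding T_def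
    using bilinear_comp_linear[OF bilinear_pure_tensor[OF assms(1) NP] linear_maps_id
        bilinear_left[OF bilinear_pure_tensor[OF assms(2,3)] that]] by simp
  have param: "(\<lambda>p. ?\<beta> p m n) \<in> linear_maps K P T" if "m \<in> carrier M" "n \<in> carrier N" for m n
    unfolding T_def
    using linear_maps_comp[OF bilinear_right[OF bilinear_pure_tensor[OF assms(2,3)] that(2)]
        bilinear_right[OF bilinear_pure_tensor[OF assms(1) NP] that(1)]]
    by (simp add: comp_def)
  show "bilinear K (tensor K M N) P T (\<lambda>t p. tensor_lift K T (?\<beta> p) t)"
  proof (rule bilinearI)
    show "(\<lambda>p. tensor_lift K T (?\<beta> p) t) \<in> linear_maps K P T" if "t \<in> carrier (tensor K M N)" for t
      by (rule tensor_lift_linear_parameter[OF assms(1,2) T assms(3) \<beta> param that])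
    show "(\<lambda>t. tensor_lift K T (?\<beta> p) t) \<in> linear_maps K (tensor K M N) T" if "p \<in> carrier P" for p
      using tensor_lift_linear[OF assms(1,2) T \<beta>[OF that]] by simp
  qed
qed

lemma tensor_assoc_linear:
  assumes "module K M" "module K N" "module K P"
  shows "tensor_assoc K M N P \<in>
    linear_maps K (tensor K (tensor K M N) P) (tensor K M (tensor K N P))"
  unfolding tensor_assoc_def Let_def
  by (intro tensor_lift_linear module_tensor tensor_assoc_bilinear assms)

lemma tensor_assoc_pure:
  assumes "module K M" "module K N" "module K P"
    and "m \<in> carrier M" "n \<in> carrier N" "p \<in> carrier P"
  shows "tensor_assoc K M N P (pure_tensor K (tensor K M N) P (pure_tensor K M N m n) p) =
    pure_tensor K M (tensor K N P) m (pure_tensor K N P n p)"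
  unfolding tensor_assoc_def Let_def
  \<comment> \<open>The instantiations of \<open>M\<close> fix the order: the outer lift, whose left
    factor is itself a tensor product, is unfolded before the inner one.\<close>
  by (subst tensor_lift_pure[where M = "tensor K M N"],
      (intro tensor_assoc_bilinear module_tensor pure_tensor_closed assms)+,
      subst tensor_lift_pure[where M = M],
      (intro tensor_assoc_bilinear module_tensor assms refl)+)

lemma tensor_unassoc_bilinear:
  assumes "module K M" "module K N" "module K P"
  defines "T \<equiv> tensor K (tensor K M N) P"
  shows "m \<in> carrier M \<Longrightarrow>
      bilinear K N P T (\<lambda>n p. pure_tensor K (tensor K M N) P (pure_tensor K M N m n) p)"
    and "bilinear K M (tensor K N P) T (\<lambda>m t. tensor_lift K T
      (\<lambda>n p. pure_tensor K (tensor K M N) P (pure_tensor K M N m n) p) t)"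
proof -
  let ?\<beta> = "\<lambda>m n p. pure_tensor K (tensor K M N) P (pure_tensor K M N m n) p"
  note MN = module_tensor[OF assms(1,2)]
  have T: "module K T" unfolding T_def by (intro module_tensor assms(3) MN)
  show \<beta>: "bilinear K N P T (?\<beta> m)" if "m \<in> carrier M" for m
    unfolding T_def
    using bilinear_comp_linear[OF bilinear_pure_tensor[OF MN assms(3)]
        bilinear_right[OF bilinear_pure_tensor[OF assms(1,2)] that] linear_maps_id] by simp
  have param: "(\<lambda>m. ?\<beta> m n p) \<in> linear_maps K M T" if "n \<in> carrier N" "p \<in> carrier P" for n p
    unfolding T_def
    using linear_maps_comp[OF bilinear_left[OF bilinear_pure_tensor[OF assms(1,2)] that(1)]
        bilinear_left[OF bilinear_pure_tensor[OF MN assms(3)] that(2)]]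
    by (simp add: comp_def)
  show "bilinear K M (tensor K N P) T (\<lambda>m t. tensor_lift K T (?\<beta> m) t)"
  proof (rule bilinearI)
    show "(\<lambda>m. tensor_lift K T (?\<beta> m) t) \<in> linear_maps K M T" if "t \<in> carrier (tensor K N P)" for t
      by (rule tensor_lift_linear_parameter[OF assms(2,3) T assms(1) \<beta> param that])
    show "(\<lambda>t. tensor_lift K T (?\<beta> m) t) \<in> linear_maps K (tensor K N P) T" if "m \<in> carrier M" for m
      using tensor_lift_linear[OF assms(2,3) T \<beta>[OF that]] by simp
  qed
qed

lemma tensor_unassoc_linear:
  assumes "module K M" "module K N" "module K P"
  shows "tensor_unassoc K M N P \<in>
    linear_maps K (tensor K M (tensor K N P)) (tensor K (tensor K M N) P)"
  unfolding tensor_unassoc_def Let_def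
  by (intro tensor_lift_linear module_tensor tensor_unassoc_bilinear assms)

lemma tensor_unassoc_pure:
  assumes "module K M" "module K N" "module K P"
    and "m \<in> carrier M" "n \<in> carrier N" "p \<in> carrier P"
  shows "tensor_unassoc K M N P (pure_tensor K M (tensor K N P) m (pure_tensor K N P n p)) =
    pure_tensor K (tensor K M N) P (pure_tensor K M N m n) p"
  unfolding tensor_unassoc_def Let_def
  by (subst tensor_lift_pure[where M = M],
      (intro tensor_unassoc_bilinear module_tensor pure_tensor_closed assms)+,
      subst tensor_lift_pure[where M = N],
      (intro tensor_unassoc_bilinear module_tensor assms refl)+)

section \<open>Algebra multiplication as a linear map on the tensor square\<close>

lemma unital_algebra_module: "unital_algebra K A \<Longrightarrow> module K A"
  by (simp add: unital_algebra_def)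

lemma mult_bilinear:
  assumes "unital_algebra K A"
  shows "bilinear K A A A (\<lambda>x y. x \<otimes>\<^bsub>A\<^esub> y)"
proof -
  interpret A: unital_algebra K A by fact
  show ?thesis
    by (intro bilinearI linear_mapsI)
      (auto simp: A.smult_mult_left A.smult_mult_right A.l_distr A.r_distr)
qed

lemma mult_map_linear:
  "unital_algebra K A \<Longrightarrow> mult_map K A \<in> linear_maps K (tensor K A A) A"
  unfolding mult_map_def by (intro tensor_lift_linear mult_bilinear unital_algebra_module)

lemma mult_map_pure:
  "unital_algebra K A \<Longrightarrow> x \<in> carrier A \<Longrightarrow> y \<in> carrier A \<Longrightarrow>
    mult_map K A (pure_tensor K A A x y) = x \<otimes>\<^bsub>A\<^esub> y"
  unfolding mult_map_def by (intro tensor_lift_pure mult_bilinear unital_algebra_module)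

section \<open>Smash products\<close>

lemma linear_left_mult:
  "unital_algebra K A \<Longrightarrow> a \<in> carrier A \<Longrightarrow> (\<lambda>x. a \<otimes>\<^bsub>A\<^esub> x) \<in> linear_maps K A A"
  using bilinear_right[OF mult_bilinear] by metis

lemma linear_right_mult:
  "unital_algebra K A \<Longrightarrow> a \<in> carrier A \<Longrightarrow> (\<lambda>x. x \<otimes>\<^bsub>A\<^esub> a) \<in> linear_maps K A A"
  using bilinear_left[OF mult_bilinear] by metis

lemma smash_product_simps:
  "carrier (smash_product K A B R) = carrier (tensor K A B)"
  "s \<oplus>\<^bsub>smash_product K A B R\<^esub> t = s \<oplus>\<^bsub>tensor K A B\<^esub> t"
  "c \<odot>\<^bsub>smash_product K A B R\<^esub> t = c \<odot>\<^bsub>tensor K A B\<^esub> t"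
  "\<one>\<^bsub>smash_product K A B R\<^esub> = pure_tensor K A B \<one>\<^bsub>A\<^esub> \<one>\<^bsub>B\<^esub>"
  by (simp_all add: smash_product_def)

text \<open>Only the \<open>mult\<close> and \<open>one\<close> fields of the tensor product are
  overwritten, and linearity mentions neither.\<close>

lemma linear_maps_smash_product:
  "linear_maps K (smash_product K A B R) X = linear_maps K (tensor K A B) X"
  by (simp add: linear_maps_def smash_product_simps)

context
  fixes K :: "('k, 'r) ring_scheme"
    and A :: "('k, 'a, 'c) module_scheme"
    and B :: "('k, 'b, 'd) module_scheme"
    and R :: "('b \<times> 'a \<Rightarrow> 'k) set \<Rightarrow> ('a \<times> 'b \<Rightarrow> 'k) set"
  assumes A: "unital_algebra K A" and B: "unital_algebra K B"
    and R: "R \<in> linear_maps K (tensor K B A) (tensor K A B)"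
begin

interpretation A: unital_algebra K A by (rule A)
interpretation B: unital_algebra K B by (rule B)

lemmas modules = unital_algebra_module[OF A] unital_algebra_module[OF B]

lemma smash_mult_map_linear:
  "smash_mult_map K A B R \<in> linear_maps K (tensor K (tensor K A B) (tensor K A B)) (tensor K A B)"
  unfolding smash_mult_map_def
  by (intro linear_maps_comp[OF tensor_assoc_linear] linear_maps_comp[OF tensor_map_linear]
      linear_maps_comp[OF tensor_unassoc_linear] tensor_map_linear tensor_assoc_linear
      tensor_unassoc_linear mult_map_linear linear_maps_id module_tensor modules A B R)

text \<open>The product is the linear map \<open>smash_mult_map\<close> after the bilinear pure
  tensor. This lets multiplicativity of a linear map be tested on pure tensors in each
  argument.\<close>

lemma smash_mult_bilinear:
  "bilinear K (tensor K A B) (tensor K A B) (tensor K A B)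
    (\<lambda>s t. s \<otimes>\<^bsub>smash_product K A B R\<^esub> t)"
  using linear_comp_bilinear[OF bilinear_pure_tensor smash_mult_map_linear] modules
  by (simp add: smash_product_def module_tensor)

text \<open>Replaces six maps with their rebracketings by a single map applied to R(b (x) a'), the
  form in which the commutation hypothesis can be used.\<close>

lemma smash_mult_pure:
  assumes "a \<in> carrier A" "b \<in> carrier B" "a' \<in> carrier A" "b' \<in> carrier B"
  shows "pure_tensor K A B a b \<otimes>\<^bsub>smash_product K A B R\<^esub> pure_tensor K A B a' b' =
    tensor_map K A B (\<lambda>x. a \<otimes>\<^bsub>A\<^esub> x) (\<lambda>y. y \<otimes>\<^bsub>B\<^esub> b') (R (pure_tensor K B A b a'))"
proof -
  let ?AB = "tensor K A B" and ?BB = "tensor K B B"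
  \<comment> \<open>What is left of the composite once R has acted, with its value R(b (x) a')
    abstracted to \<open>r\<close>.\<close>
  let ?tail = "\<lambda>r. tensor_map K A B (mult_map K A) (mult_map K B)
    (tensor_unassoc K A A ?BB
      (tensor_map K A (tensor K A ?BB) id (tensor_assoc K A B B)
        (pure_tensor K A (tensor K ?AB B) a (pure_tensor K ?AB B r b'))))"
  note linear = tensor_map_linear tensor_assoc_linear tensor_unassoc_linear mult_map_linear
    linear_maps_id module_tensor modules A B R
  have r: "R (pure_tensor K B A b a') \<in> carrier ?AB"
    by (intro linear_maps_closed[OF R] pure_tensor_closed modules assms)
  have "pure_tensor K A B a b \<otimes>\<^bsub>smash_product K A B R\<^esub> pure_tensor K A B a' b' =
      ?tail (R (pure_tensor K B A b a'))"
    by (simp add: smash_product_def smash_mult_map_def tensor_assoc_pure tensor_map_pure[where M = A]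
        tensor_map_pure[where M = "tensor K B A"]
        tensor_unassoc_pure pure_tensor_closed linear assms)
  also have "\<dots> = tensor_map K A B (\<lambda>x. a \<otimes>\<^bsub>A\<^esub> x) (\<lambda>y. y \<otimes>\<^bsub>B\<^esub> b') (R (pure_tensor K B A b a'))"
  \<comment> \<open>Both sides are linear in \<open>r\<close>, and at x (x) y both give ax (x)
    yb'.\<close>
  proof (rule linear_maps_tensor_eqI[OF _ _ modules _ r])
    have "(\<lambda>r. pure_tensor K A (tensor K ?AB B) a (pure_tensor K ?AB B r b'))
        \<in> linear_maps K ?AB (tensor K A (tensor K ?AB B))"
      using linear_maps_comp[OF
          bilinear_left[OF bilinear_pure_tensor[OF module_tensor[OF modules] modules(2)] assms(4)]
          bilinear_right[OF bilinear_pure_tensor[OF modules(1)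
              module_tensor[OF module_tensor[OF modules] modules(2)]] assms(1)]]
      by (simp add: comp_def)
    then have "tensor_map K A B (mult_map K A) (mult_map K B) \<circ> (tensor_unassoc K A A ?BB \<circ>
        (tensor_map K A (tensor K A ?BB) id (tensor_assoc K A B B) \<circ>
        (\<lambda>r. pure_tensor K A (tensor K ?AB B) a (pure_tensor K ?AB B r b'))))
        \<in> linear_maps K ?AB ?AB"
      by (rule linear_maps_comp[OF linear_maps_comp[OF linear_maps_comp[OF _ tensor_map_linear]
            tensor_unassoc_linear] tensor_map_linear]) (intro linear)+
    then show "?tail \<in> linear_maps K ?AB ?AB" by (simp add: comp_def)
    show "tensor_map K A B (\<lambda>x. a \<otimes>\<^bsub>A\<^esub> x) (\<lambda>y. y \<otimes>\<^bsub>B\<^esub> b') \<in> linear_maps K ?AB ?AB"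
      by (intro tensor_map_linear linear_left_mult linear_right_mult modules assms A B)
    fix x y assume "x \<in> carrier A" "y \<in> carrier B"
    then show "?tail (pure_tensor K A B x y) =
        tensor_map K A B (\<lambda>x. a \<otimes>\<^bsub>A\<^esub> x) (\<lambda>y. y \<otimes>\<^bsub>B\<^esub> b') (pure_tensor K A B x y)"
      by (simp add: tensor_assoc_pure tensor_map_pure[where M = A]
          tensor_map_pure[where M = "tensor K A A"] tensor_unassoc_pure mult_map_pure
          linear_left_mult linear_right_mult pure_tensor_closed linear assms)
  qed
  finally show ?thesis .
qed

text \<open>In (a # 1)(1 # b) the twist is evaluated at 1 (x) 1, which normality sends to 1 (x) 1.
  What remains is a1 (x) 1b.\<close>

lemma smash_mult_left_right:
  assumes "normal_twist K A B R" "a \<in> carrier A" "b \<in> carrier B"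
  shows "smash_left K A B a \<otimes>\<^bsub>smash_product K A B R\<^esub> smash_right K A B b = pure_tensor K A B a b"
proof -
  have "R (pure_tensor K B A \<one>\<^bsub>B\<^esub> \<one>\<^bsub>A\<^esub>) = pure_tensor K A B \<one>\<^bsub>A\<^esub> \<one>\<^bsub>B\<^esub>"
    using assms(1) by (simp add: normal_twist_def)
  then show ?thesis
    using assms(2,3)
    by (simp add: smash_left_def smash_right_def smash_mult_pure tensor_map_pure[where M = A]
        linear_left_mult linear_right_mult modules A B)
qed

end

section \<open>The induced algebra map: construction, multiplicativity and uniqueness\<close>

theorem proposition2p13:
  fixes K :: "('k, 'r) ring_scheme"
    and A :: "('k, 'a, 'c) module_scheme"
    and B :: "('k, 'b, 'd) module_scheme"
    and X :: "('k, 'x, 'e) module_scheme"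
    and R :: "('b \<times> 'a \<Rightarrow> 'k) set \<Rightarrow> ('a \<times> 'b \<Rightarrow> 'k) set"
    and u :: "'a \<Rightarrow> 'x" and v :: "'b \<Rightarrow> 'x"
  assumes "field K"
    and "unital_algebra K A" and "unital_algebra K B"
    and "R \<in> linear_maps K (tensor K B A) (tensor K A B)"
    and "normal_twist K A B R"
    and "multiplicative_twist K A B R"
    and "unital_algebra K X"
    and "u \<in> algebra_maps K A X" and "v \<in> algebra_maps K B X"
    and "\<forall>t\<in>carrier (tensor K B A).
      (mult_map K X \<circ> tensor_map K X X v u) t = (mult_map K X \<circ> tensor_map K X X u v \<circ> R) t"
  shows "\<exists>!w. w \<in> extensional (carrier (smash_product K A B R)) \<and>
    w \<in> algebra_maps K (smash_product K A B R) X \<and>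
    (\<forall>a\<in>carrier A. (w \<circ> smash_left K A B) a = u a) \<and>
    (\<forall>b\<in>carrier B. (w \<circ> smash_right K A B) b = v b)"
proof -
  note A = assms(2) and B = assms(3) and R = assms(4) and X = assms(7)
  note modules = unital_algebra_module[OF A] unital_algebra_module[OF B]
  interpret A: unital_algebra K A by (rule A)
  interpret B: unital_algebra K B by (rule B)
  interpret X: unital_algebra K X by (rule X)
  let ?T = "tensor K A B" and ?S = "smash_product K A B R"
  have u: "u \<in> linear_maps K A X" "u \<in> ring_hom A X"
    and v: "v \<in> linear_maps K B X" "v \<in> ring_hom B X"
    using assms(8,9) by (auto simp: algebra_maps_def)
  note uv_closed [simp] = linear_maps_closed[OF u(1)] linear_maps_closed[OF v(1)]
  have uv_bilinear: "bilinear K A B X (\<lambda>a b. u a \<otimes>\<^bsub>X\<^esub> v b)"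
    by (rule bilinear_comp_linear[OF mult_bilinear[OF X] u(1) v(1)])
  define w where "w = tensor_lift K X (\<lambda>a b. u a \<otimes>\<^bsub>X\<^esub> v b)"
  have w_linear: "w \<in> linear_maps K ?T X"
    unfolding w_def by (intro tensor_lift_linear uv_bilinear modules X.module_axioms)
  note w_closed [simp] = linear_maps_closed[OF w_linear]
  have w_pure [simp]: "w (pure_tensor K A B a b) = u a \<otimes>\<^bsub>X\<^esub> v b"
    if "a \<in> carrier A" "b \<in> carrier B" for a b
    unfolding w_def by (intro tensor_lift_pure uv_bilinear modules X.module_axioms that)
  have w_twist: "w (R (pure_tensor K B A b a)) = v b \<otimes>\<^bsub>X\<^esub> u a"
    if "a \<in> carrier A" "b \<in> carrier B" for a b
  proof -
    let ?t = "pure_tensor K B A b a"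
    have t: "?t \<in> carrier (tensor K B A)"
      by (intro pure_tensor_closed modules that)
    \<comment> \<open>The right side of the commutation hypothesis is \<open>w\<close> after R:
      multiplication after u (x) v agrees with \<open>w\<close> on pure tensors, hence everywhere,
      in particular at values of R.\<close>
    have "(mult_map K X \<circ> tensor_map K X X u v) r = w r" if "r \<in> carrier ?T" for r
    proof (rule linear_maps_tensor_eqI[OF _ w_linear modules _ that])
      show "mult_map K X \<circ> tensor_map K X X u v \<in> linear_maps K ?T X"
        by (intro linear_maps_comp[OF tensor_map_linear] mult_map_linear modules
            X.module_axioms X u(1) v(1))
    qed (simp add: tensor_map_pure[where M = A] mult_map_pure modules X.module_axioms X u(1) v(1))
    then have "w (R ?t) = (mult_map K X \<circ> tensor_map K X X v u) ?t"
      using assms(10) t linear_maps_closed[OF R t] by simp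
    also have "\<dots> = v b \<otimes>\<^bsub>X\<^esub> u a"
      using that
      by (simp add: tensor_map_pure[where M = B] mult_map_pure modules X.module_axioms X u(1) v(1))
    finally show ?thesis .
  qed
  \<comment> \<open>At r = x (x) y this reads u(ax) v(yb) = u(a) u(x) v(y) v(b); both sides are
    linear in \<open>r\<close>.\<close>
  have w_tensor_map: "w (tensor_map K A B (\<lambda>x. a \<otimes>\<^bsub>A\<^esub> x) (\<lambda>y. y \<otimes>\<^bsub>B\<^esub> b) r) =
      u a \<otimes>\<^bsub>X\<^esub> (w r \<otimes>\<^bsub>X\<^esub> v b)"
    if "a \<in> carrier A" "b \<in> carrier B" "r \<in> carrier ?T" for a b r
  proof (rule linear_maps_tensor_eqI[OF _ _ modules _ that(3)])
    show "(\<lambda>r. w (tensor_map K A B (\<lambda>x. a \<otimes>\<^bsub>A\<^esub> x) (\<lambda>y. y \<otimes>\<^bsub>B\<^esub> b) r)) \<in> linear_maps K ?T X"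
      using linear_maps_comp[OF tensor_map_linear[OF modules modules
            linear_left_mult[OF A that(1)] linear_right_mult[OF B that(2)]] w_linear]
      by (simp add: comp_def)
    show "(\<lambda>r. u a \<otimes>\<^bsub>X\<^esub> (w r \<otimes>\<^bsub>X\<^esub> v b)) \<in> linear_maps K ?T X"
      using linear_maps_comp[OF linear_maps_comp[OF w_linear linear_right_mult[OF X]]
          linear_left_mult[OF X], of "v b" "u a"] that(1,2)
      by (simp add: comp_def)
    show "w (tensor_map K A B (\<lambda>x. a \<otimes>\<^bsub>A\<^esub> x) (\<lambda>y. y \<otimes>\<^bsub>B\<^esub> b) (pure_tensor K A B x y)) =
        u a \<otimes>\<^bsub>X\<^esub> (w (pure_tensor K A B x y) \<otimes>\<^bsub>X\<^esub> v b)"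
      if "x \<in> carrier A" "y \<in> carrier B" for x y
      using that \<open>a \<in> carrier A\<close> \<open>b \<in> carrier B\<close>
      by (simp add: tensor_map_pure[where M = A] linear_left_mult linear_right_mult A B modules
          ring_hom_mult[OF u(2)] ring_hom_mult[OF v(2)] X.m_assoc)
  qed
  note mult = smash_mult_bilinear[OF A B R]
  have w_mult_pure: "w (pure_tensor K A B a b \<otimes>\<^bsub>?S\<^esub> pure_tensor K A B a' b') =
      w (pure_tensor K A B a b) \<otimes>\<^bsub>X\<^esub> w (pure_tensor K A B a' b')"
    if "a \<in> carrier A" "b \<in> carrier B" "a' \<in> carrier A" "b' \<in> carrier B" for a b a' b'
  proof -
    have "R (pure_tensor K B A b a') \<in> carrier ?T"
      by (intro linear_maps_closed[OF R] pure_tensor_closed modules that)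
    then show ?thesis
      using that by (simp add: smash_mult_pure[OF A B R] w_tensor_map w_twist X.m_assoc)
  qed
  \<comment> \<open>Passage from pure to arbitrary tensors, one argument at a time: here
    \<open>s\<close> stays pure and both sides are linear in \<open>t\<close>. Then
    \<open>w_mult\<close> frees \<open>s\<close> for a fixed arbitrary \<open>t\<close>.\<close>
  have w_mult_left: "w (s \<otimes>\<^bsub>?S\<^esub> t) = w s \<otimes>\<^bsub>X\<^esub> w t"
    if "s = pure_tensor K A B a b" "a \<in> carrier A" "b \<in> carrier B" "t \<in> carrier ?T" for a b s t
  proof (rule linear_maps_tensor_eqI[OF _ _ modules _ that(4)])
    have s: "s \<in> carrier ?T"
      unfolding that(1) by (intro pure_tensor_closed modules that)
    show "(\<lambda>t. w (s \<otimes>\<^bsub>?S\<^esub> t)) \<in> linear_maps K ?T X"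
      by (rule bilinear_right[OF linear_comp_bilinear[OF mult w_linear] s])
    show "(\<lambda>t. w s \<otimes>\<^bsub>X\<^esub> w t) \<in> linear_maps K ?T X"
      by (rule bilinear_right[OF bilinear_comp_linear[OF mult_bilinear[OF X] w_linear w_linear] s])
  qed (use that w_mult_pure in simp)
  have w_mult: "w (s \<otimes>\<^bsub>?S\<^esub> t) = w s \<otimes>\<^bsub>X\<^esub> w t" if "s \<in> carrier ?T" "t \<in> carrier ?T" for s t
  proof (rule linear_maps_tensor_eqI[OF _ _ modules _ that(1)])
    show "(\<lambda>s. w (s \<otimes>\<^bsub>?S\<^esub> t)) \<in> linear_maps K ?T X"
      by (rule bilinear_left[OF linear_comp_bilinear[OF mult w_linear] that(2)])
    show "(\<lambda>s. w s \<otimes>\<^bsub>X\<^esub> w t) \<in> linear_maps K ?T X"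
      by (rule bilinear_left[OF bilinear_comp_linear[OF mult_bilinear[OF X] w_linear w_linear]
            that(2)])
  qed (use that w_mult_left in simp)
  have left: "smash_left K A B a \<in> carrier ?T" if "a \<in> carrier A" for a
    unfolding smash_left_def by (intro pure_tensor_closed modules that B.one_closed)
  have right: "smash_right K A B b \<in> carrier ?T" if "b \<in> carrier B" for b
    unfolding smash_right_def by (intro pure_tensor_closed modules that A.one_closed)
  note one = ring_hom_one[OF u(2)] ring_hom_one[OF v(2)]
  have w_left: "w (smash_left K A B a) = u a" if "a \<in> carrier A" for a
    using that by (simp add: smash_left_def one)
  have w_right: "w (smash_right K A B b) = v b" if "b \<in> carrier B" for b
    using that by (simp add: smash_right_def one)
  have one_closed: "pure_tensor K A B \<one>\<^bsub>A\<^esub> \<one>\<^bsub>B\<^esub> \<in> carrier ?T"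
    by (intro pure_tensor_closed modules) auto
  interpret T: module K ?T by (rule module_tensor[OF modules])
  \<comment> \<open>Off the carrier \<open>w\<close> has whatever value the lift formula happens to
    give; restricting makes it \<open>extensional\<close> without changing it on A (x) B.\<close>
  let ?w = "restrict w (carrier ?T)"
  have "?w \<in> linear_maps K ?T X"
    by (rule linear_maps_cong[OF w_linear T.module_axioms]) simp
  moreover have "?w \<in> ring_hom ?S X"
    by (rule ring_hom_memI)
      (use one_closed in \<open>simp_all add: smash_product_simps bilinear_closed[OF mult] w_mult one
        linear_maps_add[OF w_linear]\<close>)
  ultimately have w_algebra: "?w \<in> algebra_maps K ?S X"
    by (simp add: algebra_maps_def linear_maps_smash_product)
  have unique: "w' = ?w"
    if w': "w' \<in> extensional (carrier ?S)" "w' \<in> algebra_maps K ?S X"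
      "\<forall>a\<in>carrier A. (w' \<circ> smash_left K A B) a = u a"
      "\<forall>b\<in>carrier B. (w' \<circ> smash_right K A B) b = v b" for w'
  proof -
    have w'_linear: "w' \<in> linear_maps K ?T X" and w'_hom: "w' \<in> ring_hom ?S X"
      using w'(2) by (auto simp: algebra_maps_def linear_maps_smash_product)
    \<comment> \<open>The factorisation through a # 1 and 1 # b turns the two prescribed composites
      of \<open>w'\<close> into its value on every pure tensor.\<close>
    have "w' (pure_tensor K A B a b) = w (pure_tensor K A B a b)"
      if "a \<in> carrier A" "b \<in> carrier B" for a b
    proof -
      have "w' (pure_tensor K A B a b) = w' (smash_left K A B a \<otimes>\<^bsub>?S\<^esub> smash_right K A B b)"
        using smash_mult_left_right[OF A B R assms(5) that] by simp
      also have "\<dots> = w' (smash_left K A B a) \<otimes>\<^bsub>X\<^esub> w' (smash_right K A B b)"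
        using left right that by (intro ring_hom_mult[OF w'_hom]) (simp_all add: smash_product_simps)
      finally show ?thesis using w'(3,4) that by simp
    qed
    then have "w' t = w t" if "t \<in> carrier ?T" for t
      using linear_maps_tensor_eqI[OF w'_linear w_linear modules _ that] by blast
    \<comment> \<open>Agreement on the carrier becomes equality of functions because both are
      \<open>extensional\<close> there.\<close>
    then show ?thesis
      using w'(1) by (intro extensionalityI[of _ "carrier ?T"]) (simp_all add: smash_product_simps)
  qed
  show ?thesis
  proof (rule ex1I[of _ ?w])
    show "?w \<in> extensional (carrier ?S) \<and> ?w \<in> algebra_maps K ?S X \<and>
        (\<forall>a\<in>carrier A. (?w \<circ> smash_left K A B) a = u a) \<and>
        (\<forall>b\<in>carrier B. (?w \<circ> smash_right K A B) b = v b)"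
      using w_algebra left right w_left w_right by (simp add: smash_product_simps)
  qed (use unique in blast)
qed

end
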